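(* Let $I_h$ be a signed Choquet integral with representation $I_h(X)=\int_0^1\gamma(u)F_X^{-1}(u)\,du$ and distortion weight function $\gamma$ satisfying $0<\|\gamma\|_2<\infty$. Let $g:\mathbb{R}^n\to\mathbb{R}$ be $K$-Lipschitz with respect to $\|\cdot\|_2$ with decomposition $g(\mathbf{x})=\tilde g(\mathbf{x}^{(1)})+\boldsymbol\beta^T\mathbf{x}^{(2)}$, where $\mathbf{x}=(\mathbf{x}^{(1)},\mathbf{x}^{(2)})$, $\mathbf{x}^{(1)}\in\mathbb{R}^m$, $\mathbf{x}^{(2)}\in\mathbb{R}^{n-m}$, $m\le n$, $\boldsymbol\beta\in\mathbb{R}^{n-m}$, and $\tilde g:\mathbb{R}^m\to\mathbb{R}$ is Lipschitz. Let $\mathbf{X}\in\mathcal{L}^2_n$ with $g(\mathbf{X})\in\mathcal{L}^2$ and $\epsilon>0$. (i) If $\gamma$ is non-decreasing, then $$I_h(g(\mathbf{X}))+\|\boldsymbol\beta\|_2\|\gamma\|_2\,\epsilon\le\sup_{\mathbf{Y}\in\mathcal{U}^n_\epsilon(\mathbf{X})}I_h\big(g(\mathbf{Y})\big)\le I_h(g(\mathbf{X}))+K\|\gamma\|_2\,\epsilon.$$ (ii) If $\gamma$ is non-negative, then $$\int_0^1\gamma(u)\Big(F^{-1}_{g(\mathbf{X})}(u)+\frac1{2\underline\lambda}\gamma(u)\Big)^{\uparrow}du\le\sup_{\mathbf{Y}\in\mathcal{U}^n_\epsilon(\mathbf{X})}I_h\big(g(\mathbf{Y})\big)\le\int_0^1\gamma(u)\Big(F^{-1}_{g(\mathbf{X})}(u)+\frac1{2\overline\lambda}\gamma(u)\Big)^{\uparrow}du,$$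 where $\underline\lambda$ is the unique positive solution to $$\int_0^1\left(F^{-1}_{g(\mathbf{X})}(u)-\Big(F^{-1}_{g(\mathbf{X})}(u)+\frac1{2\underline\lambda}\gamma(u)\Big)^{\uparrow}\right)^2du=\|\boldsymbol\beta\|_2^2\,\epsilon^2,$$ and $\overline\lambda$ is the unique positive solution to $$\int_0^1\left(F^{-1}_{g(\mathbf{X})}(u)-\Big(F^{-1}_{g(\mathbf{X})}(u)+\frac1{2\overline\lambda}\gamma(u)\Big)^{\uparrow}\right)^2du=K^2\,\epsilon^2.$$
   Context: All random variables/vectors live on a fixed non-atomic probability space $(\Omega,\mathcal{B},\mathbb{P})$ with $\mathcal{B}=\mathcal{B}(\mathbb{R}^n)$. $\mathcal{L}^2_n$ is the space of square-integrable $n$-dimensional random vectors, $\mathcal{L}^2=\mathcal{L}^2_1$. $\mathcal{U}^n_\epsilon(\mathbf{X})=\{\mathbf{Z}\in\mathcal{L}^2_n:W^n(F_{\mathbf{Z}},F_{\mathbf{X}})\le\epsilon\}$, where $W^n(F,G)=\inf(\mathbb{E}[\|\mathbf{X}-\mathbf{Y}\|_2^2])^{1/2}$ over all couplings with $F_{\mathbf{X}}=F$, $F_{\mathbf{Y}}=G$ (the 2-Wasserstein distance with Euclidean norm). $F^{-1}$ is the left-continuous quantile function. A signed Choquet integral is $I_h(X)=\int_{-\infty}^0[h(\mathbb{P}(X\ge x))-h(1)]\,dx+\int_0^\infty h(\mathbb{P}(X\ge x))\,dx$, where the distortion function $h:[0,1]\to\mathbb{R}$ is non-constant, of bounded variation,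 with $h(0)=0$; it is assumed finite for the random variables considered. When $h$ is absolutely continuous, $I_h(X)=\int_0^1\gamma(u)F_X^{-1}(u)\,du$ with $\gamma(u)$ the left derivative of $h$ at $1-u$. $\|\gamma\|_2=(\int_0^1\gamma(u)^2du)^{1/2}$. The isotonic projection of $\ell\in\mathcal{L}^2((0,1))$ is $\ell^\uparrow=\arg\min_{j\in\mathcal{K}}\int_0^1(j(u)-\ell(u))^2du$, with $\mathcal{K}$ the set of left-continuous non-decreasing square-integrable functions on $(0,1)$. Conventions on the decomposition: if $g$ has no linear components then $m=n$ and $\tilde g=g$ (so $\|\boldsymbol\beta\|_2=0$); otherwise the smallest possible $m$ is chosen. Standing assumption: $g$ is non-constant.
   Formalization: In (ii), if β = 0 the equation for the lower multiplier has no positive solution; its existence and uniqueness are therefore claimed only for β ≠ 0, and for β = 0 the lower bound is stated with 1/(2λ) read as 0, i.e. as the integral of γ times the isotonic projection of the quantile function. *)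

theory Defs
  imports "HOL-Probability.Probability"
begin

section \<open>Probability spaces and random vectors\<close>

definition nonatomic :: "'a measure \<Rightarrow> bool" where
  "nonatomic M \<longleftrightarrow>
     (\<forall>A\<in>sets M. 0 < emeasure M A \<longrightarrow>
        (\<exists>B\<in>sets M. B \<subseteq> A \<and> 0 < emeasure M B \<and> emeasure M B < emeasure M A))"

definition square_integrable :: "'a measure \<Rightarrow> ('a \<Rightarrow> 'b::euclidean_space) \<Rightarrow> bool" where
  "square_integrable M f \<longleftrightarrow> f \<in> borel_measurable M \<and> integrable M (\<lambda>\<omega>. (norm (f \<omega>))\<^sup>2)"

definition couplings ::
    "'b::euclidean_space measure \<Rightarrow> 'b measure \<Rightarrow> ('b \<times> 'b) measure set" where
  "couplings \<mu> \<nu> = {\<pi>. prob_space \<pi> \<and> sets \<pi> = sets borel \<and>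
     distr \<pi> borel fst = \<mu> \<and> distr \<pi> borel snd = \<nu>}"

text \<open>The 2-Wasserstein distance. It is only used for laws with finite second moments: then every
  integral below is that of an integrable function, and the set of couplings is non-empty.\<close>

definition wasserstein2 :: "'b::euclidean_space measure \<Rightarrow> 'b measure \<Rightarrow> real" where
  "wasserstein2 \<mu> \<nu> = sqrt (INF \<pi>\<in>couplings \<mu> \<nu>. \<integral>z. (norm (fst z - snd z))\<^sup>2 \<partial>\<pi>)"

definition wasserstein_ball ::
    "'a measure \<Rightarrow> ('a \<Rightarrow> 'b::euclidean_space) \<Rightarrow> real \<Rightarrow> ('a \<Rightarrow> 'b) set" where
  "wasserstein_ball M X \<epsilon> = {Z. square_integrable M Z \<and>
     wasserstein2 (distr M borel Z) (distr M borel X) \<le> \<epsilon>}"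

definition quantile :: "'a measure \<Rightarrow> ('a \<Rightarrow> real) \<Rightarrow> real \<Rightarrow> real" where
  "quantile M Z u = Inf {x. u \<le> cdf (distr M borel Z) x}"


section \<open>Signed Choquet integrals\<close>

text \<open>Variation of a function over a finite family of non-overlapping compact intervals.\<close>

definition variation_over :: "real set set \<Rightarrow> (real \<Rightarrow> real) \<Rightarrow> real" where
  "variation_over D f = (\<Sum>I\<in>D. \<bar>f (Sup I) - f (Inf I)\<bar>)"

definition bounded_variation_on :: "real set \<Rightarrow> (real \<Rightarrow> real) \<Rightarrow> bool" where
  "bounded_variation_on S f \<longleftrightarrow>
     (\<exists>B. \<forall>D. D division_of \<Union>D \<and> \<Union>D \<subseteq> S \<longrightarrow> variation_over D f \<le> B)"

definition absolutely_continuous_on :: "real set \<Rightarrow> (real \<Rightarrow> real) \<Rightarrow> bool" where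
  "absolutely_continuous_on S f \<longleftrightarrow>
     (\<forall>e>0. \<exists>d>0. \<forall>D. D division_of \<Union>D \<and> \<Union>D \<subseteq> S \<and> (\<Sum>I\<in>D. Sup I - Inf I) < d
        \<longrightarrow> variation_over D f < e)"

text \<open>Only the values of a distortion function on \<open>[0,1]\<close> matter.\<close>

definition distortion :: "(real \<Rightarrow> real) \<Rightarrow> bool" where
  "distortion h \<longleftrightarrow> h 0 = 0 \<and> \<not> h constant_on {0..1} \<and> bounded_variation_on {0..1} h"

definition choquet :: "'a measure \<Rightarrow> (real \<Rightarrow> real) \<Rightarrow> ('a \<Rightarrow> real) \<Rightarrow> real" where
  "choquet M h Z =
     (LBINT x:{..0}. h (measure M {\<omega> \<in> space M. x \<le> Z \<omega>}) - h 1) +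
     (LBINT x:{0..}. h (measure M {\<omega> \<in> space M. x \<le> Z \<omega>}))"

text \<open>An absolutely continuous function need not have a left derivative everywhere, so the weight
  is the left derivative almost everywhere; this determines all integrals involving it.\<close>

definition distortion_weight :: "(real \<Rightarrow> real) \<Rightarrow> (real \<Rightarrow> real) \<Rightarrow> bool" where
  "distortion_weight h \<gamma> \<longleftrightarrow> absolutely_continuous_on {0..1} h \<and>
     (AE u in lebesgue_on {0<..<1}. (h has_real_derivative \<gamma> u) (at_left (1 - u)))"

definition L2_norm :: "(real \<Rightarrow> real) \<Rightarrow> real" where
  "L2_norm f = sqrt (\<integral>u. (f u)\<^sup>2 \<partial>lebesgue_on {0<..<1})"


section \<open>Isotonic projection\<close>

definition isotonic_cone :: "(real \<Rightarrow> real) set" where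
  "isotonic_cone = {j. mono_on {0<..<1} j \<and> (\<forall>u\<in>{0<..<1}. continuous (at_left u) j) \<and>
     square_integrable (lebesgue_on {0<..<1}) j}"

text \<open>The minimiser is unique as a function on \<open>(0,1)\<close>, by left-continuity; its values elsewhere are
  unspecified.\<close>

definition isotonic_projection :: "(real \<Rightarrow> real) \<Rightarrow> real \<Rightarrow> real" where
  "isotonic_projection l =
     arg_min_on (\<lambda>j. \<integral>u. (j u - l u)\<^sup>2 \<partial>lebesgue_on {0<..<1}) isotonic_cone"

text \<open>The cost below is positive for every \<open>l > 0\<close> when the weight is non-negative and non-zero, so it has no
  positive solution for radius zero; that case corresponds to \<open>l = \<infinity>\<close>, where the projection of
  \<open>q\<close> itself is used.\<close>

definition shifted_projection :: "(real \<Rightarrow> real) \<Rightarrow> (real \<Rightarrow> real) \<Rightarrow> real \<Rightarrow> real \<Rightarrow> real" where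
  "shifted_projection \<gamma> q l = isotonic_projection (\<lambda>u. q u + 1 / (2 * l) * \<gamma> u)"

definition projection_cost :: "(real \<Rightarrow> real) \<Rightarrow> (real \<Rightarrow> real) \<Rightarrow> real \<Rightarrow> real" where
  "projection_cost \<gamma> q l = (\<integral>u. (q u - shifted_projection \<gamma> q l u)\<^sup>2 \<partial>lebesgue_on {0<..<1})"


section \<open>Linear components\<close>

text \<open>The set \<open>J\<close> collects the \<open>m\<close> coordinates forming \<open>x\<^sup>1\<close>; the remaining \<open>n - m\<close> form \<open>x\<^sup>2\<close>, and
  \<open>J\<close> may be empty or everything. The spaces of dimensions \<open>m\<close> and \<open>n - m\<close> are the corresponding
  coordinate subspaces of the ambient space, with the same Euclidean norm.\<close>

definition coord_subspace :: "'n::finite set \<Rightarrow> (real ^ 'n) set" where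
  "coord_subspace J = {x. \<forall>i. i \<notin> J \<longrightarrow> x $ i = 0}"

definition coord_proj :: "'n::finite set \<Rightarrow> real ^ 'n \<Rightarrow> real ^ 'n" where
  "coord_proj J x = (\<chi> i. if i \<in> J then x $ i else 0)"

definition linear_decomposition ::
    "(real ^ 'n::finite \<Rightarrow> real) \<Rightarrow> 'n set \<Rightarrow> (real ^ 'n \<Rightarrow> real) \<Rightarrow> real ^ 'n \<Rightarrow> bool" where
  "linear_decomposition g J g' \<beta> \<longleftrightarrow>
     \<beta> \<in> coord_subspace (- J) \<and>
     (\<exists>L. L-lipschitz_on (coord_subspace J) g') \<and>
     (\<forall>x. g x = g' (coord_proj J x) + \<beta> \<bullet> coord_proj (- J) x)"

end

theory Submission
  imports Defs
begin

text \<open>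
  On quantile functions everything happens in the Hilbert space \<open>L\<^sup>2(0,1)\<close>, where the Choquet
  integral is the linear functional \<open>\<langle>\<gamma>, \<cdot>\<rangle>\<close>. Since the comonotone coupling is optimal on the line and
  \<open>g\<close> is \<open>K\<close>-Lipschitz, each \<open>Y\<close> in the ball has a quantile function of \<open>g(Y)\<close> within \<open>K \<epsilon>\<close> of
  that of \<open>g(X)\<close>; Cauchy-Schwarz bounds the functional in case (i), and in case (ii) the projection
  of \<open>q + \<gamma> / (2 \<lambda>)\<close> maximises it over the isotonic functions in that ball, by Lagrange duality.
  Conversely, with \<open>U\<close> uniform such that \<open>g(X) = q(U)\<close>, moving \<open>X\<close> by
  \<open>(j - q)(U) \<beta> / \<parallel>\<beta>\<parallel>\<^sup>2\<close> turns \<open>g(X)\<close> into \<open>j(U)\<close> at cost \<open>\<parallel>j - q\<parallel> / \<parallel>\<beta>\<parallel>\<close>, so every isotonic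
  \<open>j\<close> within \<open>\<parallel>\<beta>\<parallel> \<epsilon>\<close> of \<open>q\<close> is attained.
\<close>

section \<open>Square-integrable functions\<close>

text \<open>The ball consists of vectors on the given space, so the lower bounds must be realised
  there: the uniform \<open>U\<close> with g(X) = q(U) is built from the sample point itself, even
  when g(X) has atoms, and this is what non-atomicity buys. Equality of laws alone would not do,
  since moving X by a function of \<open>U\<close> has to change g(X) pointwise. The quantile
  formula for I_h is derived from the Choquet definition. The weight is a left derivative almost
  everywhere only, which calls for a fundamental theorem of calculus for absolutely continuous
  functions with one-sided derivatives. In case (ii) the natural parameter is t = 1/(2 lambda), in
  which the cost is continuous and starts at 0. Strict monotonicity, hence uniqueness, comes from
  means: projecting preserves the mean, so changing t moves it in proportion to the integral of
  gamma, which is positive for a nonzero non-negative weight. The same estimate makes the cost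
  unbounded, hence existence.\<close>

lemma square_integrable_real:
  fixes f :: "'a \<Rightarrow> real"
  shows "square_integrable M f \<longleftrightarrow> f \<in> borel_measurable M \<and> integrable M (\<lambda>x. (f x)\<^sup>2)"
  by (simp add: square_integrable_def)

lemma square_integrable_add:
  fixes f g :: "'a \<Rightarrow> 'b::euclidean_space"
  assumes "square_integrable M f" and "square_integrable M g"
  shows "square_integrable M (\<lambda>x. f x + g x)"
proof -
  have [measurable]: "f \<in> borel_measurable M" "g \<in> borel_measurable M"
    using assms by (auto simp: square_integrable_def)
  have bd: "(norm (f x + g x))\<^sup>2 \<le> 2 * (norm (f x))\<^sup>2 + 2 * (norm (g x))\<^sup>2" for x
  proof -
    have "(norm (f x + g x))\<^sup>2 \<le> (norm (f x) + norm (g x))\<^sup>2"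
      by (intro power_mono norm_triangle_ineq) auto
    also have "\<dots> \<le> 2 * (norm (f x))\<^sup>2 + 2 * (norm (g x))\<^sup>2"
      using sum_squares_bound[of "norm (f x)" "norm (g x)"] by (simp add: power2_sum)
    finally show ?thesis .
  qed
  have "integrable M (\<lambda>x. (norm (f x + g x))\<^sup>2)"
    by (rule Bochner_Integration.integrable_bound[where f="\<lambda>x. 2 * (norm (f x))\<^sup>2 + 2 * (norm (g x))\<^sup>2"])
       (use assms bd in \<open>auto simp: square_integrable_def\<close>)
  then show ?thesis by (simp add: square_integrable_def)
qed

lemma square_integrable_scaleR:
  fixes f :: "'a \<Rightarrow> 'b::euclidean_space"
  assumes "square_integrable M f"
  shows "square_integrable M (\<lambda>x. c *\<^sub>R f x)"
  using assms by (auto simp: square_integrable_def power_mult_distrib)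

lemma square_integrable_diff:
  fixes f g :: "'a \<Rightarrow> 'b::euclidean_space"
  assumes "square_integrable M f" and "square_integrable M g"
  shows "square_integrable M (\<lambda>x. f x - g x)"
  using square_integrable_add[OF assms(1) square_integrable_scaleR[OF assms(2), of "-1"]] by simp

lemma square_integrable_cmult:
  fixes f :: "'a \<Rightarrow> real"
  assumes "square_integrable M f"
  shows "square_integrable M (\<lambda>x. c * f x)"
  using square_integrable_scaleR[OF assms, of c] by simp

lemma (in finite_measure) square_integrable_const:
  "square_integrable M (\<lambda>x. c)"
  by (simp add: square_integrable_def)

lemma square_integrable_cong_AE:
  fixes f g :: "'a \<Rightarrow> real"
  assumes "square_integrable M f" and "g \<in> borel_measurable M" and "AE x in M. g x = f x"
  shows "square_integrable M g"
proof -
  have "integrable M (\<lambda>x. (g x)\<^sup>2)"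
    using assms by (subst integrable_cong_AE[where g="\<lambda>x. (f x)\<^sup>2"]) (auto simp: square_integrable_real)
  then show ?thesis using assms by (simp add: square_integrable_real)
qed

lemma square_integrable_max_zero:
  fixes f :: "'a \<Rightarrow> real"
  assumes "square_integrable M f"
  shows "square_integrable M (\<lambda>x. max (f x) 0)"
proof -
  have "integrable M (\<lambda>x. (max (f x) 0)\<^sup>2)"
    by (rule Bochner_Integration.integrable_bound[where f="\<lambda>x. (f x)\<^sup>2"])
      (use assms in \<open>auto simp: square_integrable_real max_def\<close>)
  then show ?thesis using assms by (auto simp: square_integrable_real)
qed

lemma integrable_mult_square_integrable:
  fixes f g :: "'a \<Rightarrow> real"
  assumes "square_integrable M f" and "square_integrable M g"
  shows "integrable M (\<lambda>x. f x * g x)"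
proof -
  have [measurable]: "f \<in> borel_measurable M" "g \<in> borel_measurable M"
    using assms by (auto simp: square_integrable_def)
  have bd: "\<bar>f x * g x\<bar> \<le> (f x)\<^sup>2 + (g x)\<^sup>2" for x
  proof -
    have "2 * (\<bar>f x\<bar> * \<bar>g x\<bar>) \<le> \<bar>f x\<bar>\<^sup>2 + \<bar>g x\<bar>\<^sup>2"
      using sum_squares_bound[of "\<bar>f x\<bar>" "\<bar>g x\<bar>"] by simp
    moreover have "0 \<le> \<bar>f x\<bar> * \<bar>g x\<bar>" by simp
    ultimately show ?thesis unfolding abs_mult power2_abs by linarith
  qed
  show ?thesis
    by (rule Bochner_Integration.integrable_bound[where f="\<lambda>x. (f x)\<^sup>2 + (g x)\<^sup>2"])
       (use assms bd in \<open>auto simp: square_integrable_real\<close>)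
qed

lemma (in finite_measure) integrable_of_square_integrable:
  fixes f :: "'a \<Rightarrow> real"
  assumes "square_integrable M f"
  shows "integrable M f"
  using integrable_mult_square_integrable[OF assms square_integrable_const[of 1]] by simp

lemma integral_square_add:
  fixes f g :: "'a \<Rightarrow> real"
  assumes f: "square_integrable M f" and g: "square_integrable M g"
  shows "(\<integral>x. (f x + c * g x)\<^sup>2 \<partial>M)
    = (\<integral>x. (f x)\<^sup>2 \<partial>M) + 2 * c * (\<integral>x. f x * g x \<partial>M) + c\<^sup>2 * (\<integral>x. (g x)\<^sup>2 \<partial>M)"
proof -
  have "(f x + c * g x)\<^sup>2 = (f x)\<^sup>2 + (2 * c) * (f x * g x) + c\<^sup>2 * (g x)\<^sup>2" for x
    by (simp add: power2_eq_square algebra_simps)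
  then show ?thesis
    using f g integrable_mult_square_integrable[OF f g]
    by (simp add: square_integrable_real)
qed

text \<open>Parallelogram law about l. It drives both the existence of the projection (minimising
  sequences are Cauchy) and its quantitative uniqueness.\<close>

lemma integral_square_midpoint:
  fixes f g l :: "'a \<Rightarrow> real"
  assumes f: "square_integrable M f" and g: "square_integrable M g" and l: "square_integrable M l"
  shows "(\<integral>x. (f x / 2 + g x / 2 - l x)\<^sup>2 \<partial>M)
    = (\<integral>x. (f x - l x)\<^sup>2 \<partial>M) / 2 + (\<integral>x. (g x - l x)\<^sup>2 \<partial>M) / 2 - (\<integral>x. (f x - g x)\<^sup>2 \<partial>M) / 4"
proof -
  have "(f x / 2 + g x / 2 - l x)\<^sup>2 = (f x - l x)\<^sup>2 / 2 + (g x - l x)\<^sup>2 / 2 - (f x - g x)\<^sup>2 / 4" for x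
    by (simp add: power2_eq_square field_simps)
  then show ?thesis
    using square_integrable_diff[OF f l] square_integrable_diff[OF g l] square_integrable_diff[OF f g]
    by (simp add: square_integrable_real)
qed

lemma integral_Cauchy_Schwarz:
  fixes f g :: "'a \<Rightarrow> real"
  assumes f: "square_integrable M f" and g: "square_integrable M g"
  shows "(\<integral>x. f x * g x \<partial>M)\<^sup>2 \<le> (\<integral>x. (f x)\<^sup>2 \<partial>M) * (\<integral>x. (g x)\<^sup>2 \<partial>M)"
proof -
  define a b c where "a = (\<integral>x. (f x)\<^sup>2 \<partial>M)" and "b = (\<integral>x. f x * g x \<partial>M)" and "c = (\<integral>x. (g x)\<^sup>2 \<partial>M)"
  have q: "0 \<le> a + 2 * t * b + t\<^sup>2 * c" for t
    using integral_square_add[OF f g, of t] Bochner_Integration.integral_nonneg[of M "\<lambda>x. (f x + t * g x)\<^sup>2"]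
    unfolding a_def b_def c_def by simp
  have "0 \<le> a" "0 \<le> c" unfolding a_def c_def by auto
  have "b\<^sup>2 \<le> a * c"
  proof (cases "c = 0")
    case True
    show ?thesis
    proof (rule ccontr)
      assume "\<not> ?thesis"
      then have "b \<noteq> 0" using True by auto
      \<comment> \<open>For c = 0 the quadratic is affine in t, and this t gives it the value
        -1.\<close>
      then show False using q[of "- (a + 1) / (2 * b)"] True by (simp add: field_simps)
    qed
  next
    case False
    then have "c > 0" using \<open>0 \<le> c\<close> by simp
    \<comment> \<open>t = -b/c minimises the quadratic.\<close>
    have "0 \<le> c * (a + 2 * (- b / c) * b + (- b / c)\<^sup>2 * c)"
      using q[of "- b / c"] \<open>c > 0\<close> by (intro mult_nonneg_nonneg) auto
    also have "\<dots> = a * c - b\<^sup>2"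
      using \<open>c > 0\<close> by (simp add: field_simps power2_eq_square)
    finally show ?thesis by simp
  qed
  then show ?thesis unfolding a_def b_def c_def .
qed

lemma (in prob_space) integral_power2_le:
  fixes f :: "'a \<Rightarrow> real"
  assumes "square_integrable M f"
  shows "(\<integral>x. f x \<partial>M)\<^sup>2 \<le> (\<integral>x. (f x)\<^sup>2 \<partial>M)"
  using integral_Cauchy_Schwarz[OF assms square_integrable_const[of 1]] by (simp add: prob_space)

section \<open>The unit interval\<close>

abbreviation "L01 \<equiv> lebesgue_on {0<..<1::real}"

interpretation L01: prob_space L01
  by (rule prob_spaceI) (simp add: emeasure_restrict_space)

lemma space_L01 [simp]: "space L01 = {0<..<1}"
  by (simp add: space_restrict_space)

lemma prob_L01 [simp]: "measure L01 {0<..<1} = 1"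
  using L01.prob_space by simp

lemma mono_on_measurable_L01:
  fixes f :: "real \<Rightarrow> real"
  assumes "mono_on {0<..<1} f"
  shows "f \<in> borel_measurable L01"
proof -
  have "f \<in> borel_measurable (restrict_space borel {0<..<1})"
    using assms by (rule borel_measurable_mono_on_fnc)
  then show ?thesis
    by (auto simp: measurable_def sets_restrict_space space_restrict_space)
qed

lemma AE_L01_countable:
  assumes "countable A"
  shows "AE u in L01. u \<notin> A"
proof -
  have "A \<in> null_sets lebesgue"
    using countable_imp_null_set_lborel[OF assms] by (rule null_sets_completionI)
  then have "AE u in lebesgue. u \<notin> A" by (rule AE_not_in)
  then show ?thesis by (auto simp: AE_restrict_space_iff elim: eventually_mono)
qed

section \<open>Isotonic projection\<close>

lemma isotonic_coneD:
  assumes "j \<in> isotonic_cone"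
  shows "mono_on {0<..<1} j" and "square_integrable L01 j"
  using assms by (auto simp: isotonic_cone_def)

lemma isotonic_cone_const: "(\<lambda>u. c) \<in> isotonic_cone"
  by (auto simp: isotonic_cone_def mono_on_def L01.square_integrable_const)

lemma isotonic_cone_add:
  assumes "j \<in> isotonic_cone" "k \<in> isotonic_cone"
  shows "(\<lambda>u. j u + k u) \<in> isotonic_cone"
  using assms unfolding isotonic_cone_def
  by (auto intro!: square_integrable_add continuous_intros add_mono simp: mono_on_def)

lemma isotonic_cone_scale:
  assumes "j \<in> isotonic_cone" "0 \<le> c"
  shows "(\<lambda>u. c * j u) \<in> isotonic_cone"
  using assms unfolding isotonic_cone_def
  by (auto intro!: square_integrable_cmult continuous_intros mult_left_mono simp: mono_on_def)

text \<open>The supremum over v < u is left-continuous and differs from f only where it jumps, hence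
  on a countable set. It repairs almost everywhere limits of cone elements, which stay monotone but
  may lose left-continuity.\<close>

lemma left_continuous_modification:
  fixes f :: "real \<Rightarrow> real"
  assumes f: "mono_on {0<..<1} f"
  obtains j where "mono_on {0<..<1} j" and "\<And>u. u \<in> {0<..<1} \<Longrightarrow> continuous (at_left u) j"
    and "AE u in L01. j u = f u"
proof
  define j where "j u = (SUP v\<in>{0<..<u}. f v)" for u
  have bdd: "bdd_above (f ` {0<..<u})" if "u \<in> {0<..<1}" for u
    using that f by (intro bdd_aboveI[of _ "f u"]) (auto simp: mono_on_def)
  have ne: "f ` {0<..<u} \<noteq> {}" if "u \<in> {0<..<1}" for u using that by auto
  have le: "f v \<le> j u" if "u \<in> {0<..<1}" "v \<in> {0<..<u}" for u v
    unfolding j_def using that bdd by (intro cSUP_upper) auto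
  have jf: "j u \<le> f u" if "u \<in> {0<..<1}" for u
    unfolding j_def using that f by (intro cSUP_least) (auto simp: mono_on_def)
  show mono: "mono_on {0<..<1} j"
  proof (rule mono_onI)
    fix u v :: real assume uv: "u \<in> {0<..<1}" "v \<in> {0<..<1}" "u \<le> v"
    show "j u \<le> j v" unfolding j_def[of u]
      using uv by (intro cSUP_least le) auto
  qed
  show "continuous (at_left u) j" if u: "u \<in> {0<..<1}" for u
  proof -
    have "(j \<longlongrightarrow> j u) (at_left u)"
    proof (rule order_tendstoI)
      fix a assume "a < j u"
      then obtain v where v: "v \<in> {0<..<u}" "a < f v"
        unfolding j_def using less_cSUP_iff[of "{0<..<u}" f a] bdd[OF u] u by auto
      have "eventually (\<lambda>w. w \<in> {v<..<u}) (at_left u)"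
        using v by (intro eventually_at_leftI[of v]) auto
      then show "eventually (\<lambda>w. a < j w) (at_left u)"
      proof eventually_elim
        case (elim w)
        then have "f v \<le> j w" using u v by (intro le) auto
        then show ?case using v by simp
      qed
    next
      fix a assume a: "j u < a"
      have "eventually (\<lambda>w. w \<in> {0<..<u}) (at_left u)"
        using u by (intro eventually_at_leftI[of 0]) auto
      then show "eventually (\<lambda>w. j w < a) (at_left u)"
      proof eventually_elim
        case (elim w)
        then have "j w \<le> j u" using u mono by (auto simp: mono_on_def)
        then show ?case using a by simp
      qed
    qed
    then show ?thesis by (simp add: continuous_within)
  qed
  have "countable {u\<in>{0<..<1}. \<not> isCont j u}"
    by (rule mono_on_ctble_discont_open[OF _ mono]) auto
  then have "AE u in L01. u \<notin> {u\<in>{0<..<1}. \<not> isCont j u}"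
    by (rule AE_L01_countable)
  then show "AE u in L01. j u = f u"
    using AE_space
  proof eventually_elim
    case (elim u)
    then have u: "u \<in> {0<..<1}" and cont: "isCont j u" by auto
    \<comment> \<open>For w > u the supremum defining j w includes f u, so continuity of j at u
      bounds f u by j u.\<close>
    have "(j \<longlongrightarrow> j u) (at_right u)"
      using cont by (auto simp: isCont_def filterlim_at_split)
    moreover have "eventually (\<lambda>w. f u \<le> j w) (at_right u)"
      using u by (intro eventually_at_rightI[of u 1] le) auto
    ultimately have "f u \<le> j u"
      by (intro tendsto_lowerbound[of j "j u" "at_right u"]) auto
    then show ?case using jf[OF u] by simp
  qed
qed

lemma isotonic_cone_modification:
  assumes f: "mono_on {0<..<1} f" and sq: "square_integrable L01 f"
  obtains j where "j \<in> isotonic_cone" and "AE u in L01. j u = f u"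
proof -
  obtain j where j: "mono_on {0<..<1} j" "\<And>u. u \<in> {0<..<1} \<Longrightarrow> continuous (at_left u) j"
     "AE u in L01. j u = f u" using left_continuous_modification[OF f] by metis
  have "square_integrable L01 j"
    by (rule square_integrable_cong_AE[OF sq mono_on_measurable_L01[OF j(1)] j(3)])
  then have "j \<in> isotonic_cone" using j by (auto simp: isotonic_cone_def)
  then show ?thesis using j that by blast
qed

text \<open>The midpoint of j and k is again in the cone, so its squared distance to l is at least
  d. Hence near-minimisers are close to each other.\<close>

lemma integral_square_diff_le_midpoint:
  assumes j: "j \<in> isotonic_cone" and k: "k \<in> isotonic_cone" and l: "square_integrable L01 l"
    and min: "\<And>i. i \<in> isotonic_cone \<Longrightarrow> d \<le> (\<integral>u. (i u - l u)\<^sup>2 \<partial>L01)"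
  shows "(\<integral>u. (j u - k u)\<^sup>2 \<partial>L01)
    \<le> 2 * (\<integral>u. (j u - l u)\<^sup>2 \<partial>L01) + 2 * (\<integral>u. (k u - l u)\<^sup>2 \<partial>L01) - 4 * d"
proof -
  have "(\<lambda>u. j u / 2 + k u / 2) \<in> isotonic_cone"
    using isotonic_cone_scale[OF isotonic_cone_add[OF j k], of "1/2"] by (simp add: add_divide_distrib)
  from min[OF this] show ?thesis
    using integral_square_midpoint[OF isotonic_coneD(2)[OF j] isotonic_coneD(2)[OF k] l] by simp
qed

text \<open>A fast minimising sequence converges almost everywhere, Fatou's lemma bounds the cost of
  the limit by the infimum, and the limit is made left-continuous at the end.\<close>

lemma isotonic_minimiser_exists:
  assumes l: "square_integrable L01 l"
  shows "\<exists>j\<in>isotonic_cone. \<forall>k\<in>isotonic_cone. (\<integral>u. (j u - l u)\<^sup>2 \<partial>L01) \<le> (\<integral>u. (k u - l u)\<^sup>2 \<partial>L01)"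
proof -
  define D where "D j = (\<integral>u. (j u - l u)\<^sup>2 \<partial>L01)" for j
  define d where "d = (INF j\<in>isotonic_cone. D j)"
  have bdd: "bdd_below (D ` isotonic_cone)"
    by (rule bdd_belowI[of _ 0]) (auto simp: D_def)
  have ne: "isotonic_cone \<noteq> {}" using isotonic_cone_const by blast
  have d: "d \<le> D j" if "j \<in> isotonic_cone" for j
    unfolding d_def using that bdd by (intro cINF_lower) auto
  \<comment> \<open>The excess 4^-n / 4 makes squared consecutive distances at most 4 * 4^-n, so the
    L1 distances are summable.\<close>
  have "\<exists>j. j \<in> isotonic_cone \<and> D j < d + (1/4)^n / 4" for n :: nat
    using cINF_less_iff[OF ne bdd, of "d + (1/4)^n / 4"] unfolding d_def by auto
  then obtain j where j: "\<And>n. j n \<in> isotonic_cone" and jd: "\<And>n. D (j n) < d + (1/4)^n / 4"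
    by metis
  have sq: "square_integrable L01 (j n)" for n using j isotonic_coneD by blast
  then have meas [measurable]: "j n \<in> borel_measurable L01" for n
    by (simp add: square_integrable_real)
  have meas_l [measurable]: "l \<in> borel_measurable L01" using l by (simp add: square_integrable_real)
  have step: "(\<integral>u. \<bar>j (Suc n) u - j n u\<bar> \<partial>L01) \<le> 2 * (1/2)^n" for n
  proof -
    have sqd: "square_integrable L01 (\<lambda>u. \<bar>j (Suc n) u - j n u\<bar>)"
      using square_integrable_diff[OF sq[of "Suc n"] sq[of n]] by (simp add: square_integrable_real)
    have "(\<integral>u. \<bar>j (Suc n) u - j n u\<bar> \<partial>L01)\<^sup>2 \<le> (\<integral>u. (j (Suc n) u - j n u)\<^sup>2 \<partial>L01)"
      using L01.integral_power2_le[OF sqd] by simp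
    also have "\<dots> \<le> 2 * D (j (Suc n)) + 2 * D (j n) - 4 * d"
      using integral_square_diff_le_midpoint[OF j[of "Suc n"] j[of n] l, of d] d unfolding D_def by simp
    also have "\<dots> \<le> (2 * (1/2)^n)\<^sup>2"
    proof -
      have "(2 * (1/2)^n)\<^sup>2 = 4 * (1/4 :: real)^n"
        by (simp add: power_mult_distrib power2_eq_square flip: power_mult_distrib)
      moreover have "0 \<le> (1/4 :: real)^n" by simp
      ultimately show ?thesis using jd[of n] jd[of "Suc n"] unfolding power_Suc by linarith
    qed
    finally show ?thesis by (rule power2_le_imp_le) auto
  qed
  have nn_step: "(\<integral>\<^sup>+u. ennreal \<bar>j (Suc n) u - j n u\<bar> \<partial>L01) \<le> ennreal (2 * (1/2)^n)" for n
  proof -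
    have "integrable L01 (\<lambda>u. \<bar>j (Suc n) u - j n u\<bar>)"
      using L01.integrable_of_square_integrable[OF square_integrable_diff[OF sq[of "Suc n"] sq[of n]]] by simp
    then show ?thesis using step[of n] by (subst nn_integral_eq_integral) (auto simp: ennreal_leI)
  qed
  have "(\<integral>\<^sup>+u. (\<Sum>n. ennreal \<bar>j (Suc n) u - j n u\<bar>) \<partial>L01)
      = (\<Sum>n. \<integral>\<^sup>+u. ennreal \<bar>j (Suc n) u - j n u\<bar> \<partial>L01)"
    by (rule nn_integral_suminf) simp
  also have "\<dots> \<le> (\<Sum>n. ennreal (2 * (1/2)^n))"
    by (intro suminf_le nn_step) auto
  also have "\<dots> < \<infinity>"
  proof -
    have "(\<lambda>n. 2 * (1/2 :: real)^n) sums (2 * (1 / (1 - 1/2)))"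
      by (intro sums_mult geometric_sums) simp
    then show ?thesis by (subst suminf_ennreal_eq) auto
  qed
  finally have "AE u in L01. (\<Sum>n. ennreal \<bar>j (Suc n) u - j n u\<bar>) \<noteq> \<infinity>"
    by (intro nn_integral_PInf_AE) auto
  then have conv: "AE u in L01. convergent (\<lambda>n. j n u)"
  proof eventually_elim
    case (elim u)
    then have "summable (\<lambda>n. \<bar>j (Suc n) u - j n u\<bar>)"
      by (intro summable_suminf_not_top) auto
    then have "summable (\<lambda>n. j (Suc n) u - j n u)" by (rule summable_rabs_cancel)
    then have "convergent (\<lambda>n. \<Sum>i<n. j (Suc i) u - j i u)" by (simp add: summable_iff_convergent)
    moreover have "(\<lambda>n. \<Sum>i<n. j (Suc i) u - j i u) = (\<lambda>n. j n u - j 0 u)"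
      by (rule ext, rule sum_lessThan_telescope)
    ultimately show ?case by (simp add: convergent_diff_const_right_iff)
  qed
  \<comment> \<open>The liminf in \<open>ereal\<close> is monotone at every point of (0,1); the
    almost everywhere limit would give this only off a null set.\<close>
  define L where "L u = liminf (\<lambda>n. ereal (j n u))" for u
  have Lconv: "AE u in L01. \<bar>L u\<bar> \<noteq> \<infinity> \<and> (\<lambda>n. j n u) \<longlonglongrightarrow> real_of_ereal (L u)"
    using conv
  proof eventually_elim
    case (elim u)
    then obtain x where x: "(\<lambda>n. j n u) \<longlonglongrightarrow> x" by (auto simp: convergent_def)
    then have "(\<lambda>n. ereal (j n u)) \<longlonglongrightarrow> ereal x" by simp
    then have "L u = ereal x" unfolding L_def by (rule lim_imp_Liminf[rotated]) simp
    then show ?case using x by simp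
  qed
  have Lmono: "L u \<le> L v" if "u \<in> {0<..<1}" "v \<in> {0<..<1}" "u \<le> v" for u v
    unfolding L_def
  proof (rule Liminf_mono, rule always_eventually, rule allI)
    show "ereal (j n u) \<le> ereal (j n v)" for n
      using isotonic_coneD(1)[OF j[of n]] that by (auto simp: mono_on_def)
  qed
  have dense: "\<exists>v\<in>{a<..<b}. \<bar>L v\<bar> \<noteq> \<infinity>" if "0 \<le> a" "a < b" "b \<le> 1" for a b
  proof (rule ccontr)
    assume "\<not> ?thesis"
    then have *: "\<bar>L v\<bar> = \<infinity>" if "v \<in> {a<..<b}" for v using that by blast
    have "AE u in L01. u \<notin> {a<..<b}" using Lconv
    proof eventually_elim
      case (elim u)
      then show ?case using *[of u] by (metis)
    qed
    moreover have "{a<..<b} \<in> sets L01"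
      using that by (subst sets_restrict_space_iff) auto
    moreover have "{u\<in>space L01. \<not> u \<notin> {a<..<b}} = {a<..<b}" using that by auto
    ultimately have "emeasure L01 {a<..<b} = 0"
      using AE_iff_measurable[of "{a<..<b}" L01 "\<lambda>u. u \<notin> {a<..<b}"] by blast
    then have "emeasure lebesgue {a<..<b} = 0"
      using that by (subst (asm) emeasure_restrict_space) auto
    then show False using that by simp
  qed
  \<comment> \<open>Monotonicity traps L u between finite values taken on either side of u.\<close>
  have fin: "\<bar>L u\<bar> \<noteq> \<infinity>" if u: "u \<in> {0<..<1}" for u
  proof -
    obtain v w where "v \<in> {0<..<u}" "\<bar>L v\<bar> \<noteq> \<infinity>" "w \<in> {u<..<1}" "\<bar>L w\<bar> \<noteq> \<infinity>"
      using dense[of 0 u] dense[of u 1] u by auto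
    then show ?thesis using Lmono[of v u] Lmono[of u w] u by (cases "L u"; cases "L v"; cases "L w") auto
  qed
  define f where "f u = real_of_ereal (L u)" for u
  have fmono: "mono_on {0<..<1} f"
  proof (rule mono_onI)
    fix u v :: real assume uv: "u \<in> {0<..<1}" "v \<in> {0<..<1}" "u \<le> v"
    then show "f u \<le> f v" using Lmono[OF uv] fin[of u] fin[of v]
      unfolding f_def by (cases "L u"; cases "L v") auto
  qed
  have [measurable]: "f \<in> borel_measurable L01" by (rule mono_on_measurable_L01[OF fmono])
  have "(\<integral>\<^sup>+u. ennreal ((f u - l u)\<^sup>2) \<partial>L01) = (\<integral>\<^sup>+u. liminf (\<lambda>n. ennreal ((j n u - l u)\<^sup>2)) \<partial>L01)"
  proof (rule nn_integral_cong_AE)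
    show "AE u in L01. ennreal ((f u - l u)\<^sup>2) = liminf (\<lambda>n. ennreal ((j n u - l u)\<^sup>2))"
      using Lconv
    proof eventually_elim
      case (elim u)
      then have "(\<lambda>n. ennreal ((j n u - l u)\<^sup>2)) \<longlonglongrightarrow> ennreal ((f u - l u)\<^sup>2)"
        unfolding f_def by (intro tendsto_intros) auto
      then show ?case by (intro lim_imp_Liminf[symmetric]) auto
    qed
  qed
  also have "\<dots> \<le> liminf (\<lambda>n. \<integral>\<^sup>+u. ennreal ((j n u - l u)\<^sup>2) \<partial>L01)"
    by (rule nn_integral_liminf) simp
  also have "\<dots> = liminf (\<lambda>n. ennreal (D (j n)))"
    unfolding D_def using square_integrable_diff[OF sq l]
    by (subst nn_integral_eq_integral) (auto simp: square_integrable_real)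
  also have "\<dots> \<le> liminf (\<lambda>n. ennreal (d + (1/4)^n / 4))"
    using jd by (intro Liminf_mono always_eventually allI ennreal_leI) (auto intro: less_imp_le)
  also have "\<dots> = ennreal d"
  proof (rule lim_imp_Liminf)
    have "(\<lambda>n. ennreal (d + (1/4)^n / 4)) \<longlonglongrightarrow> ennreal (d + 0 / 4)"
      by (intro tendsto_intros LIMSEQ_power_zero) auto
    then show "(\<lambda>n. ennreal (d + (1/4)^n / 4)) \<longlonglongrightarrow> ennreal d" by simp
  qed simp
  finally have nn: "(\<integral>\<^sup>+u. ennreal ((f u - l u)\<^sup>2) \<partial>L01) \<le> ennreal d" .
  have d0: "0 \<le> d" unfolding d_def by (rule cINF_greatest[OF ne]) (auto simp: D_def)
  have int: "integrable L01 (\<lambda>u. (f u - l u)\<^sup>2)"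
    using le_less_trans[OF nn] by (intro integrableI_nonneg) auto
  then have "square_integrable L01 (\<lambda>u. f u - l u)" by (simp add: square_integrable_real)
  from square_integrable_add[OF this l] have fsq: "square_integrable L01 f" by simp
  have Df: "D f \<le> d"
    using nn int d0 unfolding D_def by (subst (asm) nn_integral_eq_integral) auto
  obtain i where i: "i \<in> isotonic_cone" "AE u in L01. i u = f u"
    using isotonic_cone_modification[OF fmono fsq] by metis
  have [measurable]: "i \<in> borel_measurable L01"
    using mono_on_measurable_L01 isotonic_coneD i by blast
  have "D i = D f" unfolding D_def using i(2) by (intro integral_cong_AE) auto
  then have "\<forall>k\<in>isotonic_cone. D i \<le> D k" using Df d by force
  then show ?thesis using i(1) unfolding D_def by blast
qed

lemma
  assumes "square_integrable L01 l"
  shows isotonic_projection_in_cone: "isotonic_projection l \<in> isotonic_cone"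
    and isotonic_projection_le: "\<And>k. k \<in> isotonic_cone \<Longrightarrow>
      (\<integral>u. (isotonic_projection l u - l u)\<^sup>2 \<partial>L01) \<le> (\<integral>u. (k u - l u)\<^sup>2 \<partial>L01)"
proof -
  let ?D = "\<lambda>j. \<integral>u. (j u - l u)\<^sup>2 \<partial>L01"
  have "\<exists>j. is_arg_min ?D (\<lambda>x. x \<in> isotonic_cone) j"
    using isotonic_minimiser_exists[OF assms] unfolding is_arg_min_def by (metis not_less)
  then have *: "is_arg_min ?D (\<lambda>x. x \<in> isotonic_cone) (isotonic_projection l)"
    unfolding isotonic_projection_def arg_min_on_def arg_min_def by (rule someI_ex)
  show "isotonic_projection l \<in> isotonic_cone" using * by (simp add: is_arg_min_def)
  show "?D (isotonic_projection l) \<le> ?D k" if "k \<in> isotonic_cone" for k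
    using * that by (auto simp: is_arg_min_def not_less)
qed

text \<open>Half of the variational inequality for projections onto convex sets suffices below; it
  comes from the parallelogram law at the midpoint of the two points.\<close>

lemma isotonic_projection_gap:
  assumes l: "square_integrable L01 l" and k: "k \<in> isotonic_cone"
  shows "(\<integral>u. (isotonic_projection l u - l u)\<^sup>2 \<partial>L01)
      + (\<integral>u. (k u - isotonic_projection l u)\<^sup>2 \<partial>L01) / 2 \<le> (\<integral>u. (k u - l u)\<^sup>2 \<partial>L01)"
  using integral_square_diff_le_midpoint[OF k isotonic_projection_in_cone[OF l] l isotonic_projection_le[OF l]]
  by simp

text \<open>q is a competitor at distance 0. This identifies the projection at t = 0.\<close>

lemma isotonic_projection_AE_self:
  assumes q: "q \<in> isotonic_cone"
  shows "AE u in L01. isotonic_projection q u = q u"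
proof -
  note l = isotonic_coneD(2)[OF q]
  have sq: "square_integrable L01 (\<lambda>u. isotonic_projection q u - q u)"
    using isotonic_coneD(2)[OF isotonic_projection_in_cone[OF l]] l by (rule square_integrable_diff)
  have "(\<integral>u. (isotonic_projection q u - q u)\<^sup>2 \<partial>L01) \<le> 0"
    using isotonic_projection_le[OF l q] by simp
  then have "(\<integral>u. (isotonic_projection q u - q u)\<^sup>2 \<partial>L01) = 0"
    by (intro antisym) auto
  then have "AE u in L01. (isotonic_projection q u - q u)\<^sup>2 = 0"
    using sq by (subst (asm) integral_nonneg_eq_0_iff_AE) (auto simp: square_integrable_real)
  then show ?thesis by simp
qed

text \<open>Constants lie in the lineality space of the cone, so the residual is orthogonal to them.\<close>

lemma integral_isotonic_projection:
  assumes l: "square_integrable L01 l"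
  shows "(\<integral>u. isotonic_projection l u \<partial>L01) = (\<integral>u. l u \<partial>L01)"
proof -
  define p where "p = isotonic_projection l"
  have p: "p \<in> isotonic_cone" unfolding p_def by (rule isotonic_projection_in_cone[OF l])
  note psq = isotonic_coneD(2)[OF p]
  define m where "m = (\<integral>u. p u - l u \<partial>L01)"
  have "(\<lambda>u. p u + (- m)) \<in> isotonic_cone" by (rule isotonic_cone_add[OF p isotonic_cone_const])
  from isotonic_projection_le[OF l this]
  have "(\<integral>u. (p u - l u)\<^sup>2 \<partial>L01) \<le> (\<integral>u. ((p u - l u) + (- m) * 1)\<^sup>2 \<partial>L01)"
    unfolding p_def by (simp add: algebra_simps)
  also have "\<dots> = (\<integral>u. (p u - l u)\<^sup>2 \<partial>L01) - m\<^sup>2"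
    by (subst integral_square_add[OF square_integrable_diff[OF psq l] L01.square_integrable_const])
      (simp add: m_def[symmetric] power2_eq_square)
  finally have "m = 0" by simp
  then show ?thesis
    using L01.integrable_of_square_integrable[OF psq] L01.integrable_of_square_integrable[OF l]
    unfolding m_def p_def by simp
qed

section \<open>The Lagrange parameter\<close>

context
  fixes \<gamma> q :: "real \<Rightarrow> real"
  assumes q: "q \<in> isotonic_cone" and \<gamma>: "square_integrable L01 \<gamma>"
begin

text \<open>The parameter t stands for 1/(2 lambda): the value t = 0, that is lambda infinite,
  becomes admissible and the cost becomes increasing.\<close>

definition penalized :: "real \<Rightarrow> real \<Rightarrow> real" where
  "penalized t = isotonic_projection (\<lambda>u. q u + t * \<gamma> u)"

lemma square_integrable_target: "square_integrable L01 (\<lambda>u. q u + t * \<gamma> u)"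
  using isotonic_coneD(2)[OF q] \<gamma> by (intro square_integrable_add square_integrable_cmult)

lemma penalized_in_cone: "penalized t \<in> isotonic_cone"
  unfolding penalized_def by (rule isotonic_projection_in_cone[OF square_integrable_target])

text \<open>Up to terms free of j, the squared distance from j to q + t gamma is the Lagrangian of
  maximising the pairing with gamma at a given distance from q. This is
  \<open>isotonic_projection_gap\<close> rewritten for it.\<close>

lemma penalized_gap:
  assumes k: "k \<in> isotonic_cone"
  shows "(\<integral>u. (q u - penalized t u)\<^sup>2 \<partial>L01) - 2 * t * (\<integral>u. \<gamma> u * penalized t u \<partial>L01)
      + (\<integral>u. (k u - penalized t u)\<^sup>2 \<partial>L01) / 2
    \<le> (\<integral>u. (q u - k u)\<^sup>2 \<partial>L01) - 2 * t * (\<integral>u. \<gamma> u * k u \<partial>L01)"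
proof -
  have *: "(\<integral>u. (j u - (q u + t * \<gamma> u))\<^sup>2 \<partial>L01)
    = (\<integral>u. (q u - j u)\<^sup>2 \<partial>L01) - 2 * t * (\<integral>u. \<gamma> u * j u \<partial>L01)
      + 2 * t * (\<integral>u. \<gamma> u * q u \<partial>L01) + t\<^sup>2 * (\<integral>u. (\<gamma> u)\<^sup>2 \<partial>L01)"
    if j: "j \<in> isotonic_cone" for j
  proof -
    note sq = isotonic_coneD(2)[OF q] isotonic_coneD(2)[OF j]
    have "(\<integral>u. (j u - (q u + t * \<gamma> u))\<^sup>2 \<partial>L01) = (\<integral>u. ((q u - j u) + t * \<gamma> u)\<^sup>2 \<partial>L01)"
      by (intro Bochner_Integration.integral_cong) (auto simp: power2_eq_square algebra_simps)
    also have "\<dots> = (\<integral>u. (q u - j u)\<^sup>2 \<partial>L01) + 2 * t * (\<integral>u. (q u - j u) * \<gamma> u \<partial>L01)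
        + t\<^sup>2 * (\<integral>u. (\<gamma> u)\<^sup>2 \<partial>L01)"
      by (rule integral_square_add[OF square_integrable_diff[OF sq] \<gamma>])
    also have "(\<integral>u. (q u - j u) * \<gamma> u \<partial>L01) = (\<integral>u. \<gamma> u * q u \<partial>L01) - (\<integral>u. \<gamma> u * j u \<partial>L01)"
      using integrable_mult_square_integrable[OF \<gamma> sq(1)] integrable_mult_square_integrable[OF \<gamma> sq(2)]
      by (subst Bochner_Integration.integral_diff[symmetric]) (auto simp: algebra_simps)
    finally show ?thesis by (simp add: algebra_simps)
  qed
  show ?thesis
    using isotonic_projection_gap[OF square_integrable_target[of t] k]
      *[OF penalized_in_cone, of t] *[OF k]
    unfolding penalized_def by simp
qed

text \<open>Weak duality: in the Lagrangian the distance term of k is no larger, so its linear term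
  cannot be larger either.\<close>

lemma penalized_optimal:
  assumes t: "0 < t" and k: "k \<in> isotonic_cone"
    and dist: "(\<integral>u. (q u - k u)\<^sup>2 \<partial>L01) \<le> (\<integral>u. (q u - penalized t u)\<^sup>2 \<partial>L01)"
  shows "(\<integral>u. \<gamma> u * k u \<partial>L01) \<le> (\<integral>u. \<gamma> u * penalized t u \<partial>L01)"
proof -
  have "0 \<le> (\<integral>u. (k u - penalized t u)\<^sup>2 \<partial>L01)" by simp
  then have "2 * t * (\<integral>u. \<gamma> u * k u \<partial>L01) \<le> 2 * t * (\<integral>u. \<gamma> u * penalized t u \<partial>L01)"
    using penalized_gap[OF k, of t] dist by linarith
  then show ?thesis using t by simp
qed

lemma integral_penalized:
  "(\<integral>u. penalized t u \<partial>L01) = (\<integral>u. q u \<partial>L01) + t * (\<integral>u. \<gamma> u \<partial>L01)"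
  unfolding penalized_def integral_isotonic_projection[OF square_integrable_target]
  using L01.integrable_of_square_integrable[OF isotonic_coneD(2)[OF q]] L01.integrable_of_square_integrable[OF \<gamma>]
  by simp

text \<open>Jensen's inequality for the difference, whose mean is known because projecting preserves
  means.\<close>

lemma integral_penalized_diff_square_ge:
  "((t - s) * (\<integral>u. \<gamma> u \<partial>L01))\<^sup>2 \<le> (\<integral>u. (penalized s u - penalized t u)\<^sup>2 \<partial>L01)"
proof -
  note sq = isotonic_coneD(2)[OF penalized_in_cone]
  have "(\<integral>u. penalized s u - penalized t u \<partial>L01) = (s - t) * (\<integral>u. \<gamma> u \<partial>L01)"
    using L01.integrable_of_square_integrable[OF sq] by (simp add: integral_penalized algebra_simps)
  then show ?thesis
    using L01.integral_power2_le[OF square_integrable_diff[OF sq[of s] sq[of t]]]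
    by (simp add: power_mult_distrib power2_commute)
qed

text \<open>Add the gap inequality at s tested with the point for t to the one at t tested with the
  point for s; the distances to q cancel.\<close>

lemma penalized_monotone:
  "(\<integral>u. (penalized s u - penalized t u)\<^sup>2 \<partial>L01)
    \<le> 2 * (t - s) * ((\<integral>u. \<gamma> u * penalized t u \<partial>L01) - (\<integral>u. \<gamma> u * penalized s u \<partial>L01))"
  using penalized_gap[OF penalized_in_cone, of s t] penalized_gap[OF penalized_in_cone, of t s]
  by (simp add: power2_commute[of "penalized t _"] algebra_simps)

text \<open>The gap inequality at s, tested with the point for t, separates the costs by at least
  d/2, and d > 0 because the two means differ.\<close>

lemma penalized_cost_strict_mono:
  assumes pos: "0 < (\<integral>u. \<gamma> u \<partial>L01)" and st: "0 \<le> s" "s < t"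
  shows "(\<integral>u. (q u - penalized s u)\<^sup>2 \<partial>L01) < (\<integral>u. (q u - penalized t u)\<^sup>2 \<partial>L01)"
proof -
  define d where "d = (\<integral>u. (penalized s u - penalized t u)\<^sup>2 \<partial>L01)"
  define c where "c = (\<integral>u. \<gamma> u * penalized t u \<partial>L01) - (\<integral>u. \<gamma> u * penalized s u \<partial>L01)"
  have "0 < ((t - s) * (\<integral>u. \<gamma> u \<partial>L01))\<^sup>2" using pos st by simp
  then have d: "0 < d" using integral_penalized_diff_square_ge[of t s] unfolding d_def by linarith
  have "d \<le> 2 * (t - s) * c" unfolding d_def c_def by (rule penalized_monotone)
  with d have "0 < (t - s) * c" by linarith
  then have "0 < c" using st by (simp add: zero_less_mult_iff)
  then have "0 \<le> 2 * s * c" using st by simp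
  moreover have "(\<integral>u. (q u - penalized s u)\<^sup>2 \<partial>L01) + 2 * s * c + d / 2 \<le> (\<integral>u. (q u - penalized t u)\<^sup>2 \<partial>L01)"
    using penalized_gap[OF penalized_in_cone, of s t] unfolding d_def c_def
    by (simp add: power2_commute[of "penalized t _"] algebra_simps)
  ultimately show ?thesis using d by linarith
qed

lemma penalized_zero: "AE u in L01. penalized 0 u = q u"
  unfolding penalized_def using isotonic_projection_AE_self[OF q] by simp

lemma penalized_cost_zero: "(\<integral>u. (q u - penalized 0 u)\<^sup>2 \<partial>L01) = 0"
  by (rule integral_eq_zero_AE) (use penalized_zero in eventually_elim, simp)

text \<open>Cauchy-Schwarz bounds the right side of \<open>penalized_monotone\<close> by a multiple
  of the square root of d, which is then divided out. Projections are nonexpansive; the factor 4 is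
  the price of using half of the variational inequality.\<close>

lemma penalized_Lipschitz:
  "(\<integral>u. (penalized s u - penalized t u)\<^sup>2 \<partial>L01) \<le> 4 * (t - s)\<^sup>2 * (\<integral>u. (\<gamma> u)\<^sup>2 \<partial>L01)"
proof -
  define d where "d = (\<integral>u. (penalized s u - penalized t u)\<^sup>2 \<partial>L01)"
  define c where "c = (\<integral>u. \<gamma> u * (penalized s u - penalized t u) \<partial>L01)"
  note sq = isotonic_coneD(2)[OF penalized_in_cone]
  have c: "c = (\<integral>u. \<gamma> u * penalized s u \<partial>L01) - (\<integral>u. \<gamma> u * penalized t u \<partial>L01)"
    unfolding c_def
    using integrable_mult_square_integrable[OF \<gamma> sq] by (simp add: right_diff_distrib)
  have "0 \<le> d" unfolding d_def by simp
  have "d \<le> 2 * (t - s) * (- c)" using penalized_monotone[of s t] unfolding d_def c by simp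
  then have "d\<^sup>2 \<le> (2 * (t - s) * (- c))\<^sup>2" using \<open>0 \<le> d\<close> by (rule power_mono)
  also have "\<dots> = 4 * (t - s)\<^sup>2 * c\<^sup>2" by (simp add: power2_eq_square algebra_simps)
  also have "\<dots> \<le> 4 * (t - s)\<^sup>2 * ((\<integral>u. (\<gamma> u)\<^sup>2 \<partial>L01) * d)"
    using integral_Cauchy_Schwarz[OF \<gamma> square_integrable_diff[OF sq[of s] sq[of t]]]
    unfolding c_def d_def by (intro mult_left_mono) auto
  finally have "d * d \<le> (4 * (t - s)\<^sup>2 * (\<integral>u. (\<gamma> u)\<^sup>2 \<partial>L01)) * d" by (simp add: power2_eq_square ac_simps)
  then show ?thesis
    using \<open>0 \<le> d\<close> unfolding d_def[symmetric] by (cases "d = 0") auto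
qed

lemma penalized_cost_continuous:
  "continuous_on UNIV (\<lambda>t. \<integral>u. (q u - penalized t u)\<^sup>2 \<partial>L01)"
proof -
  define G where "G = (\<integral>u. (\<gamma> u)\<^sup>2 \<partial>L01)"
  have "isCont (\<lambda>t. \<integral>u. (q u - penalized t u)\<^sup>2 \<partial>L01) s" for s
  proof -
    note sq = isotonic_coneD(2)[OF penalized_in_cone]
    define a where "a t = (\<integral>u. (penalized s u - penalized t u)\<^sup>2 \<partial>L01)" for t
    define b where "b t = (\<integral>u. (q u - penalized s u) * (penalized s u - penalized t u) \<partial>L01)" for t
    define D where "D = (\<integral>u. (q u - penalized s u)\<^sup>2 \<partial>L01)"
    have eq: "(\<integral>u. (q u - penalized t u)\<^sup>2 \<partial>L01) = D + 2 * b t + a t" for t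
      using integral_square_add[OF square_integrable_diff[OF isotonic_coneD(2)[OF q] sq[of s]]
          square_integrable_diff[OF sq[of s] sq[of t]], of 1]
      unfolding a_def b_def D_def by (simp add: algebra_simps)
    have b2: "(b t)\<^sup>2 \<le> D * a t" for t
      unfolding a_def b_def D_def
      by (rule integral_Cauchy_Schwarz[OF square_integrable_diff[OF isotonic_coneD(2)[OF q] sq[of s]]
          square_integrable_diff[OF sq[of s] sq[of t]]])
    have a0: "0 \<le> a t" for t unfolding a_def by simp
    have ale: "a t \<le> 4 * (t - s)\<^sup>2 * G" for t unfolding a_def G_def by (rule penalized_Lipschitz)
    have lim_a: "(a \<longlongrightarrow> 0) (at s)"
    proof (rule tendsto_sandwich[of "\<lambda>_. 0" a "at s" "\<lambda>t. 4 * (t - s)\<^sup>2 * G"])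
      have "((\<lambda>t. 4 * (t - s)\<^sup>2 * G) \<longlongrightarrow> 4 * (s - s)\<^sup>2 * G) (at s)" by (intro tendsto_intros)
      then show "((\<lambda>t. 4 * (t - s)\<^sup>2 * G) \<longlongrightarrow> 0) (at s)" by simp
    qed (use a0 ale in auto)
    have "((\<lambda>t. \<bar>b t\<bar>) \<longlongrightarrow> 0) (at s)"
    proof (rule tendsto_sandwich[of "\<lambda>_. 0" _ "at s" "\<lambda>t. sqrt (D * a t)"])
      have "((\<lambda>t. sqrt (D * a t)) \<longlongrightarrow> sqrt (D * 0)) (at s)" by (intro tendsto_intros lim_a)
      then show "((\<lambda>t. sqrt (D * a t)) \<longlongrightarrow> 0) (at s)" by simp
      show "\<forall>\<^sub>F t in at s. \<bar>b t\<bar> \<le> sqrt (D * a t)" using b2 by (simp add: real_le_rsqrt)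
    qed auto
    then have lim_b: "(b \<longlongrightarrow> 0) (at s)" by (rule tendsto_rabs_zero_cancel)
    have "((\<lambda>t. D + 2 * b t + a t) \<longlongrightarrow> D + 2 * 0 + 0) (at s)" by (intro tendsto_intros lim_a lim_b)
    moreover have "a s = 0" "b s = 0" by (simp_all add: a_def b_def)
    ultimately show ?thesis unfolding isCont_def eq by simp
  qed
  then show ?thesis by (simp add: continuous_at_imp_continuous_on)
qed

text \<open>For gamma of nonzero mean the cost grows at least quadratically in t, which supplies the
  upper end for the intermediate value theorem.\<close>

lemma penalized_cost_ge:
  "(t * (\<integral>u. \<gamma> u \<partial>L01))\<^sup>2 \<le> (\<integral>u. (q u - penalized t u)\<^sup>2 \<partial>L01)"
proof -
  have "(\<integral>u. (penalized 0 u - penalized t u)\<^sup>2 \<partial>L01) = (\<integral>u. (q u - penalized t u)\<^sup>2 \<partial>L01)"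
  proof (rule integral_cong_AE)
    show "AE u in L01. (penalized 0 u - penalized t u)\<^sup>2 = (q u - penalized t u)\<^sup>2"
      using penalized_zero by eventually_elim simp
  qed (use isotonic_coneD(2)[OF penalized_in_cone] isotonic_coneD(2)[OF q] in
      \<open>auto simp: square_integrable_real intro!: borel_measurable_power borel_measurable_diff\<close>)
  then show ?thesis using integral_penalized_diff_square_ge[of t 0] by simp
qed

lemma penalized_cost_ex1:
  assumes pos: "0 < (\<integral>u. \<gamma> u \<partial>L01)" and c: "0 < c"
  shows "\<exists>!t. 0 < t \<and> (\<integral>u. (q u - penalized t u)\<^sup>2 \<partial>L01) = c\<^sup>2"
proof -
  let ?D = "\<lambda>t. \<integral>u. (q u - penalized t u)\<^sup>2 \<partial>L01"
  \<comment> \<open>At T the quadratic lower bound on the cost equals c^2.\<close>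
  define T where "T = c / (\<integral>u. \<gamma> u \<partial>L01)"
  have T: "0 < T" "c\<^sup>2 \<le> ?D T" using pos c penalized_cost_ge[of T] by (auto simp: T_def)
  obtain t where t: "0 \<le> t" "t \<le> T" "?D t = c\<^sup>2"
    using IVT'[of ?D 0 "c\<^sup>2" T] T penalized_cost_zero
      continuous_on_subset[OF penalized_cost_continuous] by auto
  have "t \<noteq> 0" using t(3) c penalized_cost_zero by auto
  then show ?thesis
  proof (intro ex1I[of _ t])
    fix s assume s: "0 < s \<and> ?D s = c\<^sup>2"
    then show "s = t"
      using penalized_cost_strict_mono[OF pos, of s t] penalized_cost_strict_mono[OF pos, of t s] t
      by (cases s t rule: linorder_cases) auto
  qed (use t in auto)
qed

lemma shifted_projection_eq: "shifted_projection \<gamma> q l = penalized (1 / (2 * l))"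
  by (simp add: shifted_projection_def penalized_def)

lemma projection_cost_ex1:
  assumes pos: "0 < (\<integral>u. \<gamma> u \<partial>L01)" and c: "0 < c"
  shows "\<exists>!l. 0 < l \<and> projection_cost \<gamma> q l = c\<^sup>2"
proof -
  obtain t where t: "0 < t" "(\<integral>u. (q u - penalized t u)\<^sup>2 \<partial>L01) = c\<^sup>2"
    and uniq: "\<And>s. 0 < s \<Longrightarrow> (\<integral>u. (q u - penalized s u)\<^sup>2 \<partial>L01) = c\<^sup>2 \<Longrightarrow> s = t"
    using penalized_cost_ex1[OF pos c] by blast
  show ?thesis
  proof (intro ex1I[of _ "1 / (2 * t)"])
    show "0 < 1 / (2 * t) \<and> projection_cost \<gamma> q (1 / (2 * t)) = c\<^sup>2"
      using t by (simp add: projection_cost_def shifted_projection_eq)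
    fix l assume l: "0 < l \<and> projection_cost \<gamma> q l = c\<^sup>2"
    then have "1 / (2 * l) = t"
      by (intro uniq) (auto simp: projection_cost_def shifted_projection_eq)
    from this[symmetric] show "l = 1 / (2 * t)" using l by simp
  qed
qed

lemma shifted_projection_optimal:
  assumes l: "0 < l" and k: "k \<in> isotonic_cone"
    and dist: "(\<integral>u. (q u - k u)\<^sup>2 \<partial>L01) \<le> projection_cost \<gamma> q l"
  shows "(\<integral>u. \<gamma> u * k u \<partial>L01) \<le> (\<integral>u. \<gamma> u * shifted_projection \<gamma> q l u \<partial>L01)"
  using penalized_optimal[of "1 / (2 * l)", OF _ k] l dist
  by (simp add: shifted_projection_eq projection_cost_def)

lemma shifted_projection_in_cone: "shifted_projection \<gamma> q l \<in> isotonic_cone"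
  unfolding shifted_projection_eq by (rule penalized_in_cone)

end

text \<open>Non-negativity of gamma enters case (ii) through this mean, whose positivity makes the
  cost strictly increasing and unbounded.\<close>

lemma integral_pos_of_L2_norm_pos:
  assumes \<gamma>: "square_integrable L01 \<gamma>" and pos: "0 < L2_norm \<gamma>"
    and nonneg: "\<And>u. u \<in> {0<..<1} \<Longrightarrow> 0 \<le> \<gamma> u"
  shows "0 < (\<integral>u. \<gamma> u \<partial>L01)"
proof -
  have int: "integrable L01 \<gamma>" by (rule L01.integrable_of_square_integrable[OF \<gamma>])
  have AE: "AE u in L01. 0 \<le> \<gamma> u" using nonneg by (intro AE_I2) simp
  then have "0 \<le> (\<integral>u. \<gamma> u \<partial>L01)" by (rule integral_nonneg_AE)
  moreover have "(\<integral>u. \<gamma> u \<partial>L01) \<noteq> 0"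
  proof
    assume "(\<integral>u. \<gamma> u \<partial>L01) = 0"
    then have "AE u in L01. \<gamma> u = 0" using integral_nonneg_eq_0_iff_AE[OF int AE] by simp
    then have "AE u in L01. (\<gamma> u)\<^sup>2 = 0" by eventually_elim simp
    then have "(\<integral>u. (\<gamma> u)\<^sup>2 \<partial>L01) = 0" by (rule integral_eq_zero_AE)
    then show False using pos by (simp add: L2_norm_def)
  qed
  ultimately show ?thesis by simp
qed

section \<open>Absolutely continuous functions\<close>

lemma absolutely_continuous_on_subset:
  assumes "absolutely_continuous_on S f" and "T \<subseteq> S"
  shows "absolutely_continuous_on T f"
  using assms unfolding absolutely_continuous_on_def by (meson subset_trans)

text \<open>The increments telescope; tagging every interval with its left end reduces this to
  tagged divisions.\<close>

lemma sum_division_increments: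
  fixes f :: "real \<Rightarrow> real"
  assumes ab: "a \<le> b" and q: "q division_of {a..b}"
  shows "(\<Sum>k\<in>q. f (Sup k) - f (Inf k)) = f b - f a"
proof -
  define p where "p = (\<lambda>k. (Inf k, k)) ` q"
  have "p tagged_division_of {a..b}"
  proof (rule tagged_division_ofI)
    show "finite p" using q by (auto simp: p_def)
    show "\<Union>{k. \<exists>x. (x, k) \<in> p} = {a..b}"
      using division_ofD(6)[OF q] unfolding p_def by blast
    fix x k assume xk: "(x, k) \<in> p"
    then have k: "k \<in> q" "x = Inf k" by (auto simp: p_def)
    then obtain c d where cd: "k = cbox c d" using division_ofD(4)[OF q] by blast
    have "k \<noteq> {}" using division_ofD(3)[OF q] k by blast
    then show "x \<in> k" using cd k by auto
    show "k \<subseteq> {a..b}" using division_ofD(2)[OF q] k by blast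
    show "\<exists>a b. k = cbox a b" using cd by blast
    fix y k' assume "(y, k') \<in> p" "(x, k) \<noteq> (y, k')"
    then show "interior k \<inter> interior k' = {}"
      using division_ofD(5)[OF q, of k k'] k by (auto simp: p_def)
  qed
  from additive_tagged_division_1[OF ab this, of f] show ?thesis
    unfolding p_def by (subst (asm) sum.reindex) (auto simp: inj_on_def)
qed

text \<open>The length is written 2r because the interval later serves as the ball of radius r
  around x - r in a Vitali cover.\<close>

lemma left_derivative_increments:
  fixes f :: "real \<Rightarrow> real"
  assumes der: "(f has_real_derivative D) (at_left x)" and "0 < e" "0 < \<delta>"
  obtains r where "0 < r" "r < \<delta>" "\<bar>f x - f (x - 2 * r) - D * (2 * r)\<bar> \<le> e * (2 * r)"
proof -
  have "((\<lambda>y. (f y - f x) / (y - x)) \<longlongrightarrow> D) (at_left x)"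
    using der by (simp add: has_field_derivative_iff)
  from tendstoD[OF this \<open>0 < e\<close>]
  have "eventually (\<lambda>y. dist ((f y - f x) / (y - x)) D < e) (at_left x)" .
  moreover have "eventually (\<lambda>y. y \<in> {x - \<delta><..<x}) (at_left x)"
    using \<open>0 < \<delta>\<close> by (intro eventually_at_leftI[of "x - \<delta>"]) auto
  ultimately have "eventually (\<lambda>y. dist ((f y - f x) / (y - x)) D < e \<and> y \<in> {x - \<delta><..<x}) (at_left x)"
    by eventually_elim auto
  then obtain y where y: "dist ((f y - f x) / (y - x)) D < e" "y \<in> {x - \<delta><..<x}"
    using eventually_happens by fastforce
  have "\<bar>f x - f y - D * (x - y)\<bar> = \<bar>(f y - f x) / (y - x) - D\<bar> * (x - y)"
  proof -
    have "\<bar>(f y - f x) / (y - x) - D\<bar> * (x - y) = \<bar>((f y - f x) / (y - x) - D) * (x - y)\<bar>"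
      using y by (simp add: abs_mult)
    also have "((f y - f x) / (y - x) - D) * (x - y) = f x - f y - D * (x - y)"
      using y by (simp add: divide_simps) (simp add: algebra_simps)
    finally show ?thesis by simp
  qed
  also have "\<dots> \<le> e * (x - y)" using y by (intro mult_right_mono) (auto simp: dist_real_def)
  finally have "\<bar>f x - f y - D * (x - y)\<bar> \<le> e * (x - y)" .
  moreover define r where "r = (x - y) / 2"
  moreover have "y = x - 2 * r" "x - y = 2 * r" by (simp_all add: r_def field_simps)
  ultimately have "\<bar>f x - f (x - 2 * r) - D * (2 * r)\<bar> \<le> e * (2 * r)" by metis
  then show ?thesis using y by (intro that[of r]) (auto simp: r_def)
qed

text \<open>A Vitali cover by intervals \<open>[x - 2r, x]\<close> on which both the increment of \<open>f\<close> and the integral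
  of \<open>\<phi>\<close> are close to \<open>\<phi> x\<close> times the length leaves over a set of small measure, where absolute
  continuity takes over.\<close>

lemma absolutely_continuous_FTC:
  fixes f \<phi> :: "real \<Rightarrow> real"
  assumes ab: "a \<le> b" and ac: "absolutely_continuous_on {a..b} f"
    and \<phi>: "\<phi> absolutely_integrable_on {a..b}" and N: "negligible N"
    and der: "\<And>x. x \<in> {a<..<b} - N \<Longrightarrow> (f has_real_derivative \<phi> x) (at_left x)"
  shows "integral {a..b} \<phi> = f b - f a"
proof -
  have int\<phi>: "\<phi> integrable_on {a..b}" using \<phi> by (rule set_lebesgue_integral_eq_integral(1))
  have bound: "\<bar>f b - f a - integral {a..b} \<phi>\<bar> \<le> e * (b - a) + 3 * e" if e: "0 < e" for e
  proof -
    obtain d where d: "0 < d" and dD: "\<And>D. D division_of \<Union>D \<Longrightarrow> \<Union>D \<subseteq> {a..b} \<Longrightarrow>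
        (\<Sum>I\<in>D. Sup I - Inf I) < d \<Longrightarrow> variation_over D f < e"
      using ac e unfolding absolutely_continuous_on_def by metis
    obtain g where g: "gauge g" and gp: "\<And>p. \<lbrakk>p tagged_partial_division_of (cbox a b); g fine p\<rbrakk> \<Longrightarrow>
             sum (\<lambda>(x,k). norm(measure lborel k *\<^sub>R \<phi> x - integral k \<phi>)) p < e"
      using Henstock_lemma[of \<phi> a b e] int\<phi> e by auto
    define Iv where "Iv i = {fst i - 2 * snd i .. fst i}" for i :: "real \<times> real"
    \<comment> \<open>The index x is the right end of its interval, matching the left derivative.
      Containment in g x is the fineness that Henstock's lemma asks for.\<close>
    define K where "K = {(x, r). x \<in> {a<..<b} - N \<and> 0 < r \<and> Iv (x, r) \<subseteq> {a..b} \<and> Iv (x, r) \<subseteq> g x \<and>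
      \<bar>f x - f (x - 2 * r) - \<phi> x * (2 * r)\<bar> \<le> e * (2 * r)}"
    have Iv: "cball (fst i - snd i) (snd i) = Iv i" for i
      unfolding Iv_def cball_eq_atLeastAtMost by auto
    have Kpos: "0 < snd i" if "i \<in> K" for i using that by (auto simp: K_def)
    obtain C where C: "countable C" "C \<subseteq> K"
      and disj: "pairwise (\<lambda>i j. disjnt (cball (fst i - snd i) (snd i)) (cball (fst j - snd j) (snd j))) C"
      and negl: "negligible (({a<..<b} - N) - (\<Union>i\<in>C. cball (fst i - snd i) (snd i)))"
    proof (rule Vitali_covering_theorem_cballs[of K snd "{a<..<b} - N" "\<lambda>i. fst i - snd i"])
      show "\<And>i. i \<in> K \<Longrightarrow> 0 < snd i" by (rule Kpos)
      fix x \<delta> :: real assume x: "x \<in> {a<..<b} - N" and \<delta>: "0 < \<delta>"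
      have "open (g x)" "x \<in> g x" using g by (auto simp: gauge_def)
      then obtain \<rho> where \<rho>: "0 < \<rho>" "ball x \<rho> \<subseteq> g x" by (meson openE)
      \<comment> \<open>The three bounds serve the Vitali condition, the gauge and containment in
        [a, b], in this order.\<close>
      obtain r where r: "0 < r" "r < Min {\<delta>, \<rho> / 2, (x - a) / 2}"
        "\<bar>f x - f (x - 2 * r) - \<phi> x * (2 * r)\<bar> \<le> e * (2 * r)"
        using left_derivative_increments[OF der[OF x] e, of "Min {\<delta>, \<rho> / 2, (x - a) / 2}"] \<delta> \<rho> x
        by auto
      have "Iv (x, r) \<subseteq> {a..b}" using r x by (auto simp: Iv_def)
      moreover have "Iv (x, r) \<subseteq> ball x \<rho>" using r by (auto simp: Iv_def dist_real_def)
      ultimately have "(x, r) \<in> K" using r x \<rho> by (auto simp: K_def)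
      then show "\<exists>i. i \<in> K \<and> x \<in> cball (fst i - snd i) (snd i) \<and> snd i < \<delta>"
        using r unfolding Iv by (intro exI[of _ "(x, r)"]) (auto simp: Iv_def)
    qed blast
    have disj': "Iv i \<inter> Iv j = {}" if "i \<in> C" "j \<in> C" "i \<noteq> j" for i j
      using disj that unfolding Iv pairwise_def disjnt_def by blast
    \<comment> \<open>Finite pieces of the countable family: their unions \<open>A n\<close> exhaust
      [a, b] up to a null set, so a large n leaves length below d.\<close>
    define F where "F n = {i\<in>C. to_nat_on C i < n}" for n
    define A where "A n = (\<Union>i\<in>F n. Iv i)" for n
    have finF: "finite (F n)" for n
    proof (rule finite_imageD)
      show "inj_on (to_nat_on C) (F n)"
        using inj_on_to_nat_on[OF C(1)] by (rule inj_on_subset) (auto simp: F_def)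
      show "finite (to_nat_on C ` F n)"
        by (rule finite_subset[of _ "{..<n}"]) (auto simp: F_def)
    qed
    have A_meas: "A n \<in> sets lebesgue" for n unfolding A_def Iv_def using finF by (intro sets.finite_UN) auto
    have A_inc: "incseq A" by (rule incseq_SucI) (auto simp: A_def F_def)
    have A_UN: "(\<Union>n. A n) = (\<Union>i\<in>C. Iv i)" by (auto simp: A_def F_def)
    have A_sub: "A n \<subseteq> {a..b}" for n using C(2) by (auto simp: A_def F_def K_def)
    have A_neg: "negligible ({a..b} - (\<Union>n. A n))"
    proof (rule negligible_subset)
      show "negligible (N \<union> {a, b} \<union> (({a<..<b} - N) - (\<Union>i\<in>C. Iv i)))"
        using negl N unfolding Iv by auto
      show "{a..b} - (\<Union>n. A n) \<subseteq> N \<union> {a, b} \<union> (({a<..<b} - N) - (\<Union>i\<in>C. Iv i))"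
        unfolding A_UN by auto
    qed
    have UN_sub: "(\<Union>n. A n) \<subseteq> {a..b}" using A_sub by blast
    have A_int: "set_integrable lebesgue (A n) \<psi>" "set_integrable lebesgue (\<Union>n. A n) \<psi>"
      if "\<psi> absolutely_integrable_on {a..b}" for \<psi> :: "real \<Rightarrow> real" and n
      using that A_sub[of n] UN_sub A_meas by (auto intro: set_integrable_subset)
    have lim: "(\<lambda>n. integral (A n) \<psi>) \<longlonglongrightarrow> integral {a..b} \<psi>"
      if \<psi>: "\<psi> absolutely_integrable_on {a..b}" for \<psi> :: "real \<Rightarrow> real"
    proof -
      have "(\<lambda>n. LINT x:A n|lebesgue. \<psi> x) \<longlonglongrightarrow> (LINT x:(\<Union>n. A n)|lebesgue. \<psi> x)"
        by (rule set_integral_cont_up[OF A_meas A_inc A_int(2)[OF \<psi>]])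
      then have "(\<lambda>n. integral (A n) \<psi>) \<longlonglongrightarrow> integral (\<Union>n. A n) \<psi>"
        using set_lebesgue_integral_eq_integral(2)[OF A_int(1)[OF \<psi>]]
          set_lebesgue_integral_eq_integral(2)[OF A_int(2)[OF \<psi>]] by simp
      moreover have "integral (\<Union>n. A n) \<psi> = integral {a..b} \<psi>"
        by (rule integral_subset_negligible[OF UN_sub A_neg])
      ultimately show ?thesis by simp
    qed
    have "(\<lambda>n. integral (A n) (\<lambda>_. 1)) \<longlonglongrightarrow> integral {a..b} (\<lambda>_. 1 :: real)"
      by (rule lim) auto
    then have "eventually (\<lambda>n. \<bar>integral (A n) (\<lambda>_. 1) - (b - a)\<bar> < d) sequentially"
      using tendstoD[OF _ d] ab by (fastforce simp: dist_real_def)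
    moreover have "eventually (\<lambda>n. \<bar>integral (A n) \<phi> - integral {a..b} \<phi>\<bar> < e) sequentially"
      using tendstoD[OF lim[OF \<phi>] e] by (simp add: dist_real_def)
    ultimately have "eventually (\<lambda>n. \<bar>integral (A n) (\<lambda>_. 1) - (b - a)\<bar> < d \<and>
        \<bar>integral (A n) \<phi> - integral {a..b} \<phi>\<bar> < e) sequentially" by eventually_elim auto
    then obtain n where n: "\<bar>integral (A n) (\<lambda>_. 1) - (b - a)\<bar> < d"
      "\<bar>integral (A n) \<phi> - integral {a..b} \<phi>\<bar> < e"
      using eventually_happens by fastforce
    define p where "p = (\<lambda>i. (fst i, Iv i)) ` F n"
    have FK: "i \<in> K" if "i \<in> F n" for i using that C by (auto simp: F_def)
    have Fne: "Iv i \<noteq> {}" "fst i \<in> Iv i" "Sup (Iv i) = fst i" "Inf (Iv i) = fst i - 2 * snd i"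
      "measure lborel (Iv i) = 2 * snd i" if "i \<in> F n" for i
      using Kpos[OF FK[OF that]] by (auto simp: Iv_def)
    have inj: "inj_on Iv (F n)"
    proof (rule inj_onI, rule ccontr)
      fix i j assume "i \<in> F n" "j \<in> F n" "Iv i = Iv j" "i \<noteq> j"
      then show False using disj'[of i j] Fne(1)[of i] by (auto simp: F_def)
    qed
    have p: "p tagged_partial_division_of cbox a b"
      unfolding tagged_partial_division_of_def
    proof (intro conjI allI impI)
      show "finite p" using finF by (simp add: p_def)
      fix x k assume xk: "(x, k) \<in> p"
      then obtain i where i: "i \<in> F n" "x = fst i" "k = Iv i" by (auto simp: p_def)
      show "x \<in> k" using Fne i by blast
      show "k \<subseteq> cbox a b" using FK[OF i(1)] i(3) by (auto simp: K_def)
      show "\<exists>a b. k = cbox a b" unfolding i(3) Iv_def box_real[symmetric] by blast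
    next
      fix x k y l assume "(x, k) \<in> p \<and> (y, l) \<in> p \<and> (x, k) \<noteq> (y, l)"
      then obtain i j where "i \<in> F n" "k = Iv i" "j \<in> F n" "l = Iv j" "i \<noteq> j" by (auto simp: p_def)
      then have "k \<inter> l = {}" using disj'[of i j] by (auto simp: F_def)
      then show "interior k \<inter> interior l = {}" using interior_subset by blast
    qed
    have fine: "g fine p"
      by (rule fineI) (use FK in \<open>fastforce simp: p_def K_def\<close>)
    have sndp: "snd ` p = Iv ` F n" by (auto simp: p_def image_image)
    have divp: "Iv ` F n division_of A n"
      using partial_division_of_tagged_division[OF p] unfolding sndp A_def .
    \<comment> \<open>The chosen intervals are completed to a division of [a, b]. The added ones,
      \<open>R\<close>, have total length below d, so f changes little over them.\<close>
    obtain q where q: "Iv ` F n \<subseteq> q" "q division_of {a..b}"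
      using partial_division_extend_interval[of "Iv ` F n" a b] divp A_sub[of n] unfolding A_def by auto
    have finq: "finite q" using q by blast
    define R where "R = q - Iv ` F n"
    have qU: "\<Union>q = {a..b}" using q by blast
    have R: "R division_of \<Union>R" "\<Union>R \<subseteq> {a..b}"
      using division_of_subset[of q R] q qU by (auto simp: R_def)
    have split: "sum G q = (\<Sum>i\<in>F n. G (Iv i)) + sum G R" for G :: "real set \<Rightarrow> real"
      using sum.subset_diff[OF q(1) finq, of G] sum.reindex[OF inj, of G] by (simp add: R_def)
    have len: "integral (A n) (\<lambda>_. 1) = (\<Sum>i\<in>F n. 2 * snd i)"
    proof -
      have "integral (A n) (\<lambda>_. 1) = (\<Sum>k\<in>Iv ` F n. integral k (\<lambda>_. 1 :: real))"
        by (rule integral_combine_division_bottomup[OF divp]) (auto simp: Iv_def)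
      also have "\<dots> = (\<Sum>i\<in>F n. integral (Iv i) (\<lambda>_. 1))" using sum.reindex[OF inj] by simp
      also have "\<dots> = (\<Sum>i\<in>F n. 2 * snd i)"
        using Kpos FK by (intro sum.cong) (force simp: Iv_def)+
      finally show ?thesis .
    qed
    have "(\<Sum>k\<in>q. Sup k - Inf k) = b - a"
      using sum_division_increments[OF ab q(2), of "\<lambda>x. x"] .
    then have "(\<Sum>k\<in>R. Sup k - Inf k) = (b - a) - (\<Sum>i\<in>F n. 2 * snd i)"
      using split[of "\<lambda>k. Sup k - Inf k"] Fne by (simp cong: sum.cong)
    then have "(\<Sum>k\<in>R. Sup k - Inf k) < d" using n(1) len by simp
    from dD[OF R this] have "variation_over R f < e" .
    then have R_small: "\<bar>\<Sum>k\<in>R. f (Sup k) - f (Inf k)\<bar> < e"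
      using sum_abs[of "\<lambda>k. f (Sup k) - f (Inf k)" R] unfolding variation_over_def by linarith
    have \<phi>A: "integral (A n) \<phi> = (\<Sum>i\<in>F n. integral (Iv i) \<phi>)"
    proof -
      have "integral (A n) \<phi> = (\<Sum>k\<in>Iv ` F n. integral k \<phi>)"
      proof (rule integral_combine_division_bottomup[OF divp])
        fix k assume "k \<in> Iv ` F n"
        then have "k \<subseteq> {a..b}" "\<exists>c d. k = {c..d}" using FK by (force simp: K_def Iv_def)+
        then show "\<phi> integrable_on k" using integrable_on_subinterval[OF int\<phi>] by auto
      qed
      then show ?thesis using sum.reindex[OF inj] by simp
    qed
    have hen: "(\<Sum>i\<in>F n. \<bar>2 * snd i * \<phi> (fst i) - integral (Iv i) \<phi>\<bar>) < e"
    proof -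
      have "inj_on (\<lambda>i. (fst i, Iv i)) (F n)" using inj by (auto simp: inj_on_def)
      then have "sum (\<lambda>(x,k). norm (measure lborel k *\<^sub>R \<phi> x - integral k \<phi>)) p
        = (\<Sum>i\<in>F n. \<bar>measure lborel (Iv i) * \<phi> (fst i) - integral (Iv i) \<phi>\<bar>)"
        unfolding p_def by (subst sum.reindex) auto
      then show ?thesis using gp[OF p fine] Fne by (simp cong: sum.cong)
    qed
    have inc: "\<bar>\<Sum>i\<in>F n. (f (fst i) - f (fst i - 2 * snd i)) - integral (Iv i) \<phi>\<bar> \<le> e * (b - a) + e"
    proof -
      have "\<bar>\<Sum>i\<in>F n. (f (fst i) - f (fst i - 2 * snd i)) - integral (Iv i) \<phi>\<bar>
        \<le> (\<Sum>i\<in>F n. \<bar>(f (fst i) - f (fst i - 2 * snd i)) - integral (Iv i) \<phi>\<bar>)" by (rule sum_abs)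
      also have "\<dots> \<le> (\<Sum>i\<in>F n. e * (2 * snd i) + \<bar>2 * snd i * \<phi> (fst i) - integral (Iv i) \<phi>\<bar>)"
      proof (rule sum_mono)
        fix i assume "i \<in> F n"
        then have "\<bar>f (fst i) - f (fst i - 2 * snd i) - \<phi> (fst i) * (2 * snd i)\<bar> \<le> e * (2 * snd i)"
          using FK by (force simp: K_def)
        then show "\<bar>(f (fst i) - f (fst i - 2 * snd i)) - integral (Iv i) \<phi>\<bar>
          \<le> e * (2 * snd i) + \<bar>2 * snd i * \<phi> (fst i) - integral (Iv i) \<phi>\<bar>"
          by (simp add: mult.commute[of "\<phi> (fst i)"])
      qed
      also have "\<dots> \<le> e * (\<Sum>i\<in>F n. 2 * snd i) + e"
        using hen by (simp add: sum.distrib sum_distrib_left)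
      also have "\<dots> \<le> e * (b - a) + e"
      proof -
        have "0 \<le> (\<Sum>k\<in>R. Sup k - Inf k)"
        proof (rule sum_nonneg)
          fix k assume "k \<in> R"
          then obtain c d where "k = cbox c d" "k \<noteq> {}"
            using division_ofD(3,4)[OF R(1)] by metis
          then show "0 \<le> Sup k - Inf k" by auto
        qed
        then show ?thesis
          using e \<open>(\<Sum>k\<in>R. Sup k - Inf k) = (b - a) - (\<Sum>i\<in>F n. 2 * snd i)\<close>
          by (auto intro!: mult_left_mono)
      qed
      finally show ?thesis .
    qed
    have "f b - f a = (\<Sum>i\<in>F n. f (fst i) - f (fst i - 2 * snd i)) + (\<Sum>k\<in>R. f (Sup k) - f (Inf k))"
      using sum_division_increments[OF ab q(2), of f] split[of "\<lambda>k. f (Sup k) - f (Inf k)"] Fne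
      by (simp cong: sum.cong)
    then show ?thesis using inc R_small n(2) \<phi>A by (simp add: sum_subtractf)
  qed
  have "\<bar>f b - f a - integral {a..b} \<phi>\<bar> \<le> 0"
  proof (rule field_le_epsilon)
    fix e :: real assume e: "0 < e"
    \<comment> \<open>The error is e per unit length from the derivative estimate, plus e each from
      Henstock's lemma, from \<open>R\<close> and from replacing [a, b] by \<open>A n\<close> in the
      integral.\<close>
    have pos: "0 < b - a + 3" using ab by simp
    have "\<bar>f b - f a - integral {a..b} \<phi>\<bar> \<le> e / (b - a + 3) * (b - a) + 3 * (e / (b - a + 3))"
      using bound[of "e / (b - a + 3)"] e pos by simp
    also have "\<dots> = e"
    proof -
      have "z * (b - a) + 3 * z = z * (b - a + 3)" for z by (simp add: algebra_simps)
      from this[of "e / (b - a + 3)"] have "e / (b - a + 3) * (b - a) + 3 * (e / (b - a + 3))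
        = e / (b - a + 3) * (b - a + 3)" .
      also have "\<dots> = e" using pos by simp
      finally show ?thesis .
    qed
    finally show "\<bar>f b - f a - integral {a..b} \<phi>\<bar> \<le> 0 + e" by simp
  qed
  then show ?thesis by simp
qed

text \<open>The substitution \<open>u = 1 - x\<close> turns the integral of the left derivative of \<open>h\<close> over \<open>[0, t]\<close> into
  one over \<open>[1 - t, 1]\<close>.\<close>

lemma distortion_eq_integral:
  assumes w: "distortion_weight h \<gamma>" and h0: "h 0 = 0" and \<gamma>: "integrable L01 \<gamma>"
    and t: "0 \<le> t" "t \<le> 1"
  shows "h t = (\<integral>u. indicator {1 - t<..} u * \<gamma> u \<partial>L01)"
proof -
  define \<phi> where "\<phi> x = \<gamma> (1 - x)" for x
  obtain N where N: "negligible N"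
    and der: "\<And>u. u \<in> {0<..<1} - N \<Longrightarrow> (h has_real_derivative \<gamma> u) (at_left (1 - u))"
  proof -
    have "AE u in lebesgue. u \<in> {0<..<1} \<longrightarrow> (h has_real_derivative \<gamma> u) (at_left (1 - u))"
      using w unfolding distortion_weight_def by (simp add: AE_restrict_space_iff)
    then obtain N where "N \<in> null_sets lebesgue"
      "{u\<in>space lebesgue. \<not> (u \<in> {0<..<1} \<longrightarrow> (h has_real_derivative \<gamma> u) (at_left (1 - u)))} \<subseteq> N"
      by (auto simp: eventually_ae_filter)
    then show ?thesis by (intro that[of N]) (auto simp: negligible_iff_null_sets)
  qed
  define N' where "N' = (\<lambda>x. 1 - x) ` N"
  have N': "negligible N'"
    unfolding N'_def using N
    by (intro negligible_differentiable_image_negligible) (auto intro!: derivative_intros)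
  have \<gamma>01: "\<gamma> absolutely_integrable_on {0<..<1}"
    using \<gamma> by (simp add: integrable_restrict_space set_integrable_def)
  moreover have "negligible {x \<in> {0<..<1} - {0..1}. \<gamma> x \<noteq> 0}"
    by (rule negligible_subset[of "{}"]) auto
  moreover have "negligible {x \<in> {0..1} - {0<..<1}. \<gamma> x \<noteq> 0}"
    by (rule negligible_subset[of "{0, 1}"]) auto
  ultimately have \<gamma>c: "\<gamma> absolutely_integrable_on {0..1}"
    by (rule absolutely_integrable_spike_set)
  have reflect: "((\<lambda>x. \<psi> (1 - x)) has_integral i) {0..t}" if "(\<psi> has_integral i) {1 - t..1}"
    for \<psi> :: "real \<Rightarrow> real" and i
  proof -
    have "(\<lambda>x. - x + 1) ` {1 - t..1} = {0..t}"
      using t by (auto simp: image_iff intro!: bexI[where x="1 - x" for x])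
    then show ?thesis using has_integral_affinity[of \<psi> i "1 - t" 1 "-1" 1] that by simp
  qed
  have "\<gamma> absolutely_integrable_on {1 - t..1}"
    using \<gamma>c t by (rule_tac set_integrable_subset[of _ "{0..1}"]) auto
  then have \<gamma>t: "\<gamma> integrable_on {1 - t..1}" "(\<lambda>u. norm (\<gamma> u)) integrable_on {1 - t..1}"
    by (auto simp: absolutely_integrable_on_def)
  have \<phi>: "\<phi> absolutely_integrable_on {0..t}"
    using reflect[OF integrable_integral[OF \<gamma>t(1)]] reflect[OF integrable_integral[OF \<gamma>t(2)]]
    unfolding absolutely_integrable_on_def \<phi>_def by blast
  have "h t = integral {0..t} \<phi>"
  proof -
    have "absolutely_continuous_on {0..t} h"
      using w t unfolding distortion_weight_def by (auto elim: absolutely_continuous_on_subset)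
    moreover have "(h has_real_derivative \<phi> x) (at_left x)" if x: "x \<in> {0<..<t} - N'" for x
    proof -
      have "1 - x \<notin> N"
      proof
        assume "1 - x \<in> N"
        then have "1 - (1 - x) \<in> N'" unfolding N'_def by (rule imageI)
        then show False using x by simp
      qed
      then show ?thesis using der[of "1 - x"] x t by (simp add: \<phi>_def)
    qed
    ultimately have "integral {0..t} \<phi> = h t - h 0"
      by (rule absolutely_continuous_FTC[OF t(1) _ \<phi> N'])
    then show ?thesis using h0 by simp
  qed
  also have "\<dots> = integral {1 - t..1} \<gamma>"
    using reflect[OF integrable_integral[OF \<gamma>t(1)]] unfolding \<phi>_def by (rule integral_unique)
  also have "\<dots> = integral {1 - t<..<1} \<gamma>"
  proof (rule integral_subset_negligible[symmetric])
    show "negligible ({1 - t..1} - {1 - t<..<1})"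
      by (rule negligible_subset[of "{1 - t, 1}"]) auto
  qed auto
  also have "\<dots> = (LINT u:{1 - t<..<1}|lebesgue. \<gamma> u)"
    by (rule set_lebesgue_integral_eq_integral(2)[symmetric])
      (rule set_integrable_subset[OF \<gamma>c], use t in auto)
  also have "\<dots> = (\<integral>u. indicator {1 - t<..} u * \<gamma> u \<partial>L01)"
    unfolding set_lebesgue_integral_def using t
    by (subst integral_restrict_space)
      (auto intro!: Bochner_Integration.integral_cong simp: indicator_def)
  finally show ?thesis .
qed

section \<open>Quantile functions\<close>

text \<open>\<open>cdf_distribution\<close> works with Lebesgue measure on Borel sets, the integrals
  here with its completion; the two agree on Borel preimages.\<close>

lemma distr_L01_eq_lborel:
  assumes "f \<in> borel_measurable (restrict_space borel {0<..<1})"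
  shows "distr L01 borel f = distr (restrict_space lborel {0<..<1}) borel f"
proof (rule measure_eqI)
  fix A :: "'a set" assume "A \<in> sets (distr L01 borel f)"
  then have A: "A \<in> sets borel" by simp
  have f': "f \<in> borel_measurable (restrict_space lborel {0<..<1})"
    using assms by (simp add: measurable_def sets_restrict_space space_restrict_space)
  have f'': "f \<in> borel_measurable L01"
    using assms by (auto simp: measurable_def sets_restrict_space space_restrict_space)
  have "f -` A \<inter> {0<..<1} \<in> sets (restrict_space borel {0<..<1::real})"
    using measurable_sets[OF assms A] by (simp add: space_restrict_space)
  then have B: "f -` A \<inter> {0<..<1} \<in> sets borel"
    by (subst (asm) sets_restrict_space_iff) auto
  show "emeasure (distr L01 borel f) A = emeasure (distr (restrict_space lborel {0<..<1}) borel f) A"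
    using A B f' f'' by (simp add: emeasure_distr emeasure_restrict_space space_restrict_space)
qed simp

context prob_space
begin

text \<open>Galois connection between quantile and distribution function; monotonicity and
  left-continuity of \<open>quantile\<close> are read off from it.\<close>

lemma quantile_le_iff:
  assumes Z: "Z \<in> borel_measurable M" and u: "u \<in> {0<..<1}"
  shows "quantile M Z u \<le> x \<longleftrightarrow> u \<le> prob {\<omega> \<in> space M. Z \<omega> \<le> x}"
proof -
  interpret D: cdf_distribution "distr M borel Z"
    unfolding cdf_distribution_def using Z by (rule real_distribution_distr)
  have "cdf (distr M borel Z) x = prob {\<omega> \<in> space M. Z \<omega> \<le> x}"
    using Z by (auto simp: cdf_def measure_distr intro!: arg_cong[where f=prob])
  then show ?thesis
    using D.pseudoinverse[of u x] u by (simp add: quantile_def)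
qed

lemma mono_on_quantile:
  assumes Z: "Z \<in> borel_measurable M"
  shows "mono_on {0<..<1} (quantile M Z)"
proof (rule mono_onI)
  fix u v :: real assume uv: "u \<in> {0<..<1}" "v \<in> {0<..<1}" "u \<le> v"
  have "v \<le> prob {\<omega> \<in> space M. Z \<omega> \<le> quantile M Z v}"
    using quantile_le_iff[OF Z uv(2)] by blast
  then show "quantile M Z u \<le> quantile M Z v"
    using quantile_le_iff[OF Z uv(1)] uv by simp
qed

lemma continuous_at_left_quantile:
  assumes Z: "Z \<in> borel_measurable M" and u: "u \<in> {0<..<1}"
  shows "continuous (at_left u) (quantile M Z)"
proof -
  have "(quantile M Z \<longlongrightarrow> quantile M Z u) (at_left u)"
  proof (rule order_tendstoI)
    fix a assume "a < quantile M Z u"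
    then have "prob {\<omega> \<in> space M. Z \<omega> \<le> a} < u"
      using quantile_le_iff[OF Z u, of a] by simp
    then have "eventually (\<lambda>v. v \<in> {max 0 (prob {\<omega> \<in> space M. Z \<omega> \<le> a})<..<u}) (at_left u)"
      using u by (intro eventually_at_leftI[of "max 0 (prob {\<omega> \<in> space M. Z \<omega> \<le> a})"]) auto
    then show "eventually (\<lambda>v. a < quantile M Z v) (at_left u)"
    proof eventually_elim
      case (elim v)
      then have v: "prob {\<omega> \<in> space M. Z \<omega> \<le> a} < v" "v < u" by auto
      then have "0 < v" by (intro le_less_trans[OF measure_nonneg])
      then show ?case using quantile_le_iff[OF Z, of v a] u v by auto
    qed
  next
    fix a assume a: "quantile M Z u < a"
    have "eventually (\<lambda>v. v \<in> {0<..<u}) (at_left u)"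
      using u by (intro eventually_at_leftI[of 0]) auto
    then show "eventually (\<lambda>v. quantile M Z v < a) (at_left u)"
    proof eventually_elim
      case (elim v)
      then have "quantile M Z v \<le> quantile M Z u"
        using u mono_on_quantile[OF Z] by (auto simp: mono_on_def)
      then show ?case using a by simp
    qed
  qed
  then show ?thesis by (simp add: continuous_within)
qed

lemma measurable_quantile:
  assumes "Z \<in> borel_measurable M"
  shows "quantile M Z \<in> borel_measurable L01"
  by (rule mono_on_measurable_L01[OF mono_on_quantile[OF assms]])

lemma distr_quantile:
  assumes Z: "Z \<in> borel_measurable M"
  shows "distr L01 borel (quantile M Z) = distr M borel Z"
proof -
  interpret D: cdf_distribution "distr M borel Z"
    unfolding cdf_distribution_def using Z by (rule real_distribution_distr)
  have "quantile M Z \<in> borel_measurable (restrict_space borel {0<..<1})"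
    by (rule borel_measurable_mono_on_fnc[OF mono_on_quantile[OF Z]])
  from distr_L01_eq_lborel[OF this] show ?thesis
    using D.distr_I_eq_M unfolding quantile_def by simp
qed

lemma
  fixes F :: "real \<Rightarrow> real"
  assumes Z: "Z \<in> borel_measurable M" and F: "F \<in> borel_measurable borel"
  shows integrable_quantile_iff: "integrable L01 (\<lambda>u. F (quantile M Z u)) \<longleftrightarrow> integrable M (\<lambda>\<omega>. F (Z \<omega>))"
    and integral_quantile: "(\<integral>u. F (quantile M Z u) \<partial>L01) = (\<integral>\<omega>. F (Z \<omega>) \<partial>M)"
proof -
  note q = measurable_quantile[OF Z]
  show "integrable L01 (\<lambda>u. F (quantile M Z u)) \<longleftrightarrow> integrable M (\<lambda>\<omega>. F (Z \<omega>))"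
    using integrable_distr_eq[OF q F] integrable_distr_eq[OF Z F] distr_quantile[OF Z] by simp
  show "(\<integral>u. F (quantile M Z u) \<partial>L01) = (\<integral>\<omega>. F (Z \<omega>) \<partial>M)"
    using integral_distr[OF q F] integral_distr[OF Z F] distr_quantile[OF Z] by simp
qed

lemma square_integrable_quantile:
  assumes "square_integrable M Z"
  shows "square_integrable L01 (quantile M Z)"
  using assms integrable_quantile_iff[of Z "\<lambda>x. x\<^sup>2"] measurable_quantile[of Z]
  by (simp add: square_integrable_real)

lemma quantile_in_isotonic_cone:
  assumes "square_integrable M Z"
  shows "quantile M Z \<in> isotonic_cone"
  using assms square_integrable_quantile[OF assms] mono_on_quantile[of Z] continuous_at_left_quantile[of Z]
  by (auto simp: isotonic_cone_def square_integrable_real)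

text \<open>Together with \<open>le_quantile_imp\<close> this locates the set where x is at most the
  quantile: it consists of the u above P(Z < x), up to the single point of equality.\<close>

lemma quantile_less_imp:
  assumes Z: "Z \<in> borel_measurable M" and u: "u \<in> {0<..<1}" and "quantile M Z u < x"
  shows "u \<le> prob {\<omega> \<in> space M. Z \<omega> < x}"
proof -
  have "u \<le> prob {\<omega> \<in> space M. Z \<omega> \<le> quantile M Z u}"
    using quantile_le_iff[OF Z u] by blast
  also have "\<dots> \<le> prob {\<omega> \<in> space M. Z \<omega> < x}"
    using assms Z by (intro finite_measure_mono) auto
  finally show ?thesis .
qed

lemma le_quantile_imp:
  assumes Z: "Z \<in> borel_measurable M" and u: "u \<in> {0<..<1}" and x: "x \<le> quantile M Z u"
  shows "prob {\<omega> \<in> space M. Z \<omega> < x} \<le> u"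
proof -
  note q = measurable_quantile[OF Z]
  have "prob {\<omega> \<in> space M. Z \<omega> < x} = measure (distr M borel Z) {..<x}"
    using Z by (auto simp: measure_distr intro!: arg_cong[where f=prob])
  also have "\<dots> = measure L01 (quantile M Z -` {..<x} \<inter> space L01)"
    unfolding distr_quantile[OF Z, symmetric] using q by (simp add: measure_distr)
  also have "\<dots> \<le> measure L01 {0<..<u}"
  \<comment> \<open>By monotonicity the quantile function can stay below x only to the left of
    u.\<close>
  proof (rule L01.finite_measure_mono)
    show "{0<..<u} \<in> sets L01" using u by (subst sets_restrict_space_iff) auto
    show "quantile M Z -` {..<x} \<inter> space L01 \<subseteq> {0<..<u}"
    proof
      fix v assume v: "v \<in> quantile M Z -` {..<x} \<inter> space L01"
      then have "\<not> u \<le> v"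
        using x mono_onD[OF mono_on_quantile[OF Z] u, of v] by auto
      then show "v \<in> {0<..<u}" using v by auto
    qed
  qed
  also have "\<dots> = u" using u by (subst measure_restrict_space) auto
  finally show ?thesis .
qed

end

section \<open>Optimality of the comonotone coupling\<close>

text \<open>Writing \<open>(a - b)\<^sup>2\<close> as a double integral over \<open>s \<le> t\<close> of the indicators of \<open>a < s, t \<le> b\<close> and of
  \<open>b < s, t \<le> a\<close> reduces optimality to the bound \<open>P(A < s) - P(B < t) \<le> P(A < s, t \<le> B)\<close>, whose left
  side, when positive, is the measure of the corresponding event for the quantile functions.\<close>

lemma triangle_area:
  assumes "a \<le> (b :: real)"
  shows "(\<integral>\<^sup>+z. indicator {z. a < fst z \<and> fst z \<le> snd z \<and> snd z \<le> b} z \<partial>(lborel \<Otimes>\<^sub>M lborel))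
    = ennreal ((b - a)\<^sup>2 / 2)"
proof -
  have "(\<integral>\<^sup>+z. indicator {z. a < fst z \<and> fst z \<le> snd z \<and> snd z \<le> b} z \<partial>(lborel \<Otimes>\<^sub>M lborel))
     = (\<integral>\<^sup>+s. \<integral>\<^sup>+t. indicator {z. a < fst z \<and> fst z \<le> snd z \<and> snd z \<le> b} (s, t) \<partial>lborel \<partial>lborel)"
    by (rule lborel.nn_integral_fst[symmetric]) measurable
  also have "\<dots> = (\<integral>\<^sup>+s. ennreal (b - s) * indicator {a..b} s \<partial>lborel)"
  proof (rule nn_integral_cong_AE)
    \<comment> \<open>The triangle excludes s = a while the interval of integration is closed, so
      the point a is discarded as a null set.\<close>
    show "AE s in lborel. (\<integral>\<^sup>+t. indicator {z. a < fst z \<and> fst z \<le> snd z \<and> snd z \<le> b} (s, t) \<partial>lborel)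
        = ennreal (b - s) * indicator {a..b} s"
      using AE_lborel_singleton[of a]
    proof eventually_elim
      case (elim s)
      have "(\<integral>\<^sup>+t. indicator {z. a < fst z \<and> fst z \<le> snd z \<and> snd z \<le> b} (s, t) \<partial>lborel)
        = (\<integral>\<^sup>+t. indicator {a..b} s * indicator {s..b} t \<partial>lborel)"
        using elim by (intro nn_integral_cong) (auto simp: indicator_def)
      also have "\<dots> = indicator {a..b} s * emeasure lborel {s..b}"
        by (simp add: nn_integral_cmult)
      finally show ?case by (auto simp: indicator_def)
    qed
  qed
  also have "\<dots> = ennreal ((- (b - b)\<^sup>2 / 2) - (- (b - a)\<^sup>2 / 2))"
    using assms
    by (intro nn_integral_FTC_Icc) (auto intro!: derivative_eq_intros simp: field_simps)
  finally show ?thesis by simp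
qed

text \<open>At most one of the two triangles is nonempty; the factor 2 undoes the half in its
  area.\<close>

lemma square_distance_eq_triangles:
  "ennreal ((a - b)\<^sup>2) =
    2 * ((\<integral>\<^sup>+z. indicator {z. a < fst z \<and> fst z \<le> snd z \<and> snd z \<le> b} z \<partial>(lborel \<Otimes>\<^sub>M lborel))
      + (\<integral>\<^sup>+z. indicator {z. b < fst z \<and> fst z \<le> snd z \<and> snd z \<le> a} z \<partial>(lborel \<Otimes>\<^sub>M lborel)))"
proof -
  have *: "ennreal ((a - b)\<^sup>2) =
    2 * ((\<integral>\<^sup>+z. indicator {z. a < fst z \<and> fst z \<le> snd z \<and> snd z \<le> b} z \<partial>(lborel \<Otimes>\<^sub>M lborel))
      + (\<integral>\<^sup>+z. indicator {z. b < fst z \<and> fst z \<le> snd z \<and> snd z \<le> a} z \<partial>(lborel \<Otimes>\<^sub>M lborel)))"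
    if "a \<le> b" for a b :: real
  proof -
    have "{z. b < fst z \<and> fst z \<le> snd z \<and> snd z \<le> a} = {}" using that by auto
    then show ?thesis
      using triangle_area[OF that] ennreal_mult'[of 2 "(b - a)\<^sup>2 / 2"]
      by (simp add: power2_commute[of a b])
  qed
  show ?thesis
  proof (cases "a \<le> b")
    case False
    then show ?thesis using *[of b a] by (simp add: power2_commute add.commute)
  qed (rule *)
qed

lemma (in sigma_finite_measure) nn_integral_triangle:
  fixes A B :: "'a \<Rightarrow> real"
  assumes [measurable]: "A \<in> borel_measurable M" "B \<in> borel_measurable M"
  shows "(\<integral>\<^sup>+\<omega>. (\<integral>\<^sup>+z. indicator {z. A \<omega> < fst z \<and> fst z \<le> snd z \<and> snd z \<le> B \<omega>} z \<partial>(lborel \<Otimes>\<^sub>M lborel)) \<partial>M)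
    = (\<integral>\<^sup>+z. indicator {z. fst z \<le> snd z} z * emeasure M {\<omega>\<in>space M. A \<omega> < fst z \<and> snd z \<le> B \<omega>} \<partial>(lborel \<Otimes>\<^sub>M lborel))"
proof -
  interpret LL: sigma_finite_measure "lborel \<Otimes>\<^sub>M lborel :: (real \<times> real) measure"
    by (simp add: lborel_prod sigma_finite_lborel)
  interpret pair_sigma_finite M "lborel \<Otimes>\<^sub>M lborel :: (real \<times> real) measure" ..
  have "(\<integral>\<^sup>+\<omega>. (\<integral>\<^sup>+z. indicator {z. A \<omega> < fst z \<and> fst z \<le> snd z \<and> snd z \<le> B \<omega>} z \<partial>(lborel \<Otimes>\<^sub>M lborel)) \<partial>M)
    = (\<integral>\<^sup>+z. (\<integral>\<^sup>+\<omega>. indicator {z. A \<omega> < fst z \<and> fst z \<le> snd z \<and> snd z \<le> B \<omega>} z \<partial>M) \<partial>(lborel \<Otimes>\<^sub>M lborel))"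
    by (rule Fubini'[symmetric]) measurable
  also have "\<dots> = (\<integral>\<^sup>+z. indicator {z. fst z \<le> snd z} z * emeasure M {\<omega>\<in>space M. A \<omega> < fst z \<and> snd z \<le> B \<omega>} \<partial>(lborel \<Otimes>\<^sub>M lborel))"
  proof (rule nn_integral_cong)
    fix z :: "real \<times> real"
    have "(\<integral>\<^sup>+\<omega>. indicator {z. A \<omega> < fst z \<and> fst z \<le> snd z \<and> snd z \<le> B \<omega>} z \<partial>M)
      = (\<integral>\<^sup>+\<omega>. indicator {z. fst z \<le> snd z} z * indicator {\<omega>\<in>space M. A \<omega> < fst z \<and> snd z \<le> B \<omega>} \<omega> \<partial>M)"
      by (intro nn_integral_cong) (auto simp: indicator_def)
    also have "\<dots> = indicator {z. fst z \<le> snd z} z * emeasure M {\<omega>\<in>space M. A \<omega> < fst z \<and> snd z \<le> B \<omega>}"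
      by (subst nn_integral_cmult) auto
    finally show "(\<integral>\<^sup>+\<omega>. indicator {z. A \<omega> < fst z \<and> fst z \<le> snd z \<and> snd z \<le> B \<omega>} z \<partial>M)
      = indicator {z. fst z \<le> snd z} z * emeasure M {\<omega>\<in>space M. A \<omega> < fst z \<and> snd z \<le> B \<omega>}" .
  qed
  finally show ?thesis .
qed

lemma (in prob_space) emeasure_quantile_le:
  assumes A [measurable]: "A \<in> borel_measurable M" and B [measurable]: "B \<in> borel_measurable M"
  shows "emeasure L01 {u\<in>space L01. quantile M A u < s \<and> t \<le> quantile M B u}
    \<le> emeasure M {\<omega>\<in>space M. A \<omega> < s \<and> t \<le> B \<omega>}"
proof -
  define a b where "a = prob {\<omega>\<in>space M. A \<omega> < s}" and "b = prob {\<omega>\<in>space M. B \<omega> < t}"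
  have "a \<le> prob ({\<omega>\<in>space M. A \<omega> < s \<and> t \<le> B \<omega>} \<union> {\<omega>\<in>space M. B \<omega> < t})"
    unfolding a_def by (intro finite_measure_mono) auto
  also have "\<dots> \<le> prob {\<omega>\<in>space M. A \<omega> < s \<and> t \<le> B \<omega>} + b"
    unfolding b_def by (intro measure_Un_le) auto
  finally have ab: "a - b \<le> prob {\<omega>\<in>space M. A \<omega> < s \<and> t \<le> B \<omega>}" by simp
  have sub: "{u\<in>space L01. quantile M A u < s \<and> t \<le> quantile M B u} \<subseteq> {b..a}"
    using quantile_less_imp[OF A] le_quantile_imp[OF B] unfolding a_def b_def by auto
  have "{u\<in>space L01. quantile M A u < s \<and> t \<le> quantile M B u} \<in> sets L01"
    using measurable_quantile[OF A] measurable_quantile[OF B] by measurable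
  then have sets: "{u\<in>space L01. quantile M A u < s \<and> t \<le> quantile M B u} \<in> sets lebesgue"
    by (subst (asm) sets_restrict_space_iff) auto
  have "emeasure L01 {u\<in>space L01. quantile M A u < s \<and> t \<le> quantile M B u}
      = emeasure lebesgue {u\<in>space L01. quantile M A u < s \<and> t \<le> quantile M B u}"
    by (subst emeasure_restrict_space) auto
  also have "\<dots> \<le> emeasure lebesgue {b..a}"
    using sub by (intro emeasure_mono) auto
  also have "\<dots> \<le> ennreal (prob {\<omega>\<in>space M. A \<omega> < s \<and> t \<le> B \<omega>})"
    using ab by (cases "b \<le> a") (auto intro: ennreal_leI)
  finally show ?thesis by (simp add: emeasure_eq_measure)
qed

lemma (in prob_space) quantile_coupling_optimal:
  assumes A [measurable]: "A \<in> borel_measurable M" and B [measurable]: "B \<in> borel_measurable M"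
  shows "(\<integral>\<^sup>+u. ennreal ((quantile M A u - quantile M B u)\<^sup>2) \<partial>L01) \<le> (\<integral>\<^sup>+\<omega>. ennreal ((A \<omega> - B \<omega>)\<^sup>2) \<partial>M)"
proof -
  note [measurable] = measurable_quantile[OF A] measurable_quantile[OF B]
  have meas: "(\<lambda>\<omega>. \<integral>\<^sup>+z. indicator {z. f \<omega> < fst z \<and> fst z \<le> snd z \<and> snd z \<le> g \<omega>} z \<partial>(lborel \<Otimes>\<^sub>M lborel))
      \<in> borel_measurable N"
    if [measurable]: "f \<in> borel_measurable N" "g \<in> borel_measurable N" for f g :: "'z \<Rightarrow> real" and N
  proof -
    interpret LL: sigma_finite_measure "lborel \<Otimes>\<^sub>M lborel :: (real \<times> real) measure"
      by (simp add: lborel_prod sigma_finite_lborel)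
    show ?thesis by measurable
  qed
  have le: "(\<integral>\<^sup>+u. (\<integral>\<^sup>+z. indicator {z. quantile M A u < fst z \<and> fst z \<le> snd z \<and> snd z \<le> quantile M B u} z \<partial>(lborel \<Otimes>\<^sub>M lborel)) \<partial>L01)
    \<le> (\<integral>\<^sup>+\<omega>. (\<integral>\<^sup>+z. indicator {z. A \<omega> < fst z \<and> fst z \<le> snd z \<and> snd z \<le> B \<omega>} z \<partial>(lborel \<Otimes>\<^sub>M lborel)) \<partial>M)"
    if A: "A \<in> borel_measurable M" and B: "B \<in> borel_measurable M" for A B
    unfolding nn_integral_triangle[OF A B] L01.nn_integral_triangle[OF measurable_quantile[OF A] measurable_quantile[OF B]]
    by (intro nn_integral_mono mult_left_mono emeasure_quantile_le A B) auto
  show ?thesis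
    unfolding square_distance_eq_triangles
    using le[OF A B] le[OF B A]
    by (simp add: nn_integral_cmult nn_integral_add meas A B measurable_quantile add_mono mult_left_mono)
qed

section \<open>The Choquet integral as a weighted quantile integral\<close>

text \<open>Fubini for a weight on a region whose sections have size m x. As gamma may change sign,
  absolute integrability is checked first, through the integral of |gamma| m.\<close>

lemma (in pair_sigma_finite) integral_section_swap:
  fixes \<gamma> m :: "'a \<Rightarrow> real"
  assumes E [measurable]: "E \<in> sets (M1 \<Otimes>\<^sub>M M2)" and \<gamma> [measurable]: "\<gamma> \<in> borel_measurable M1"
    and m: "\<And>x. x \<in> space M1 \<Longrightarrow> emeasure M2 (Pair x -` E) = ennreal (m x)" "\<And>x. x \<in> space M1 \<Longrightarrow> 0 \<le> m x"
    and int: "integrable M1 (\<lambda>x. \<gamma> x * m x)"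
  shows "(\<integral>y. (\<integral>x. indicator E (x, y) * \<gamma> x \<partial>M1) \<partial>M2) = (\<integral>x. \<gamma> x * m x \<partial>M1)"
proof -
  have sec: "Pair x -` E \<in> sets M2" for x using E by (rule sets_Pair1)
  have ind: "indicator E (x, y) = indicator (Pair x -` E) y" for x y by (simp add: indicator_def)
  have mm: "measure M2 (Pair x -` E) = m x" if "x \<in> space M1" for x
    using m[OF that] by (simp add: measure_def)
  have inner: "(\<integral>y. indicator E (x, y) * c \<partial>M2) = c * m x" if "x \<in> space M1" for x and c :: real
    using sec[of x] m[OF that] mm[OF that] unfolding ind by simp
  have "integrable (M1 \<Otimes>\<^sub>M M2) (\<lambda>(x, y). indicator E (x, y) * \<gamma> x)"
  proof (rule Fubini_integrable)
    have "integrable M1 (\<lambda>x. norm (\<gamma> x * m x))" using int by (rule integrable_norm)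
    also have "?this \<longleftrightarrow> integrable M1 (\<lambda>x. \<integral>y. norm (case (x, y) of (x, y) \<Rightarrow> indicator E (x, y) * \<gamma> x) \<partial>M2)"
    proof (rule Bochner_Integration.integrable_cong[OF refl])
      fix x assume x: "x \<in> space M1"
      have "(\<integral>y. norm (case (x, y) of (x, y) \<Rightarrow> indicator E (x, y) * \<gamma> x) \<partial>M2)
        = (\<integral>y. indicator E (x, y) * \<bar>\<gamma> x\<bar> \<partial>M2)" by (simp add: abs_mult)
      then show "norm (\<gamma> x * m x) = (\<integral>y. norm (case (x, y) of (x, y) \<Rightarrow> indicator E (x, y) * \<gamma> x) \<partial>M2)"
        using inner[OF x, of "\<bar>\<gamma> x\<bar>"] m(2)[OF x] by (auto simp: abs_mult)
    qed
    finally show "integrable M1 (\<lambda>x. \<integral>y. norm (case (x, y) of (x, y) \<Rightarrow> indicator E (x, y) * \<gamma> x) \<partial>M2)" .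
    show "AE x in M1. integrable M2 (\<lambda>y. case (x, y) of (x, y) \<Rightarrow> indicator E (x, y) * \<gamma> x)"
    proof (rule AE_I2)
      fix x assume "x \<in> space M1"
      then show "integrable M2 (\<lambda>y. case (x, y) of (x, y) \<Rightarrow> indicator E (x, y) * \<gamma> x)"
        using m(1)[of x] sec[of x] unfolding ind by (auto intro!: integrable_mult_left)
    qed
  qed measurable
  from Fubini_integral[OF this] have "(\<integral>y. (\<integral>x. indicator E (x, y) * \<gamma> x \<partial>M1) \<partial>M2)
      = (\<integral>x. (\<integral>y. indicator E (x, y) * \<gamma> x \<partial>M2) \<partial>M1)" by simp
  also have "\<dots> = (\<integral>x. \<gamma> x * m x \<partial>M1)"
    by (intro Bochner_Integration.integral_cong inner) auto
  finally show ?thesis .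
qed

text \<open>Layer-cake argument: h at a tail probability is the integral of gamma over the u with x
  at most q u. Integrating in x over each half-line and exchanging the integrals produces the
  positive and negative parts of q.\<close>

lemma (in prob_space) choquet_eq_quantile_integral:
  assumes Z: "square_integrable M Z" and h: "distortion h" and w: "distortion_weight h \<gamma>"
    and \<gamma>: "square_integrable L01 \<gamma>"
  shows "choquet M h Z = (\<integral>u. \<gamma> u * quantile M Z u \<partial>L01)"
proof -
  have Zm [measurable]: "Z \<in> borel_measurable M" using Z by (simp add: square_integrable_real)
  define q where "q = quantile M Z"
  note qsq = square_integrable_quantile[OF Z, folded q_def]
  have [measurable]: "q \<in> borel_measurable L01" "\<gamma> \<in> borel_measurable L01"
    using qsq \<gamma> by (auto simp: square_integrable_real)
  have int\<gamma>: "integrable L01 \<gamma>" by (rule L01.integrable_of_square_integrable[OF \<gamma>])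
  have h0: "h 0 = 0" using h by (simp add: distortion_def)
  note hint = distortion_eq_integral[OF w h0 int\<gamma>]
  have ind_int: "integrable L01 (\<lambda>u. indicator S u * \<gamma> u)" if "S \<inter> {0<..<1} \<in> sets L01" for S
    using integrable_mult_indicator[OF that int\<gamma>]
    by (subst Bochner_Integration.integrable_cong[OF refl]) (auto simp: indicator_def)
  have S: "{u. x \<le> q u} \<inter> {0<..<1} \<in> sets L01" "{u. q u < x} \<inter> {0<..<1} \<in> sets L01" for x
    using measurable_sets[of q L01 borel "{x..}"] measurable_sets[of q L01 borel "{..<x}"]
    by (auto simp: vimage_def)
  have hx: "h (prob {\<omega> \<in> space M. x \<le> Z \<omega>}) = (\<integral>u. indicator {u. x \<le> q u} u * \<gamma> u \<partial>L01)" for x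
  proof -
    have compl: "prob {\<omega> \<in> space M. x \<le> Z \<omega>} = 1 - prob {\<omega> \<in> space M. Z \<omega> < x}"
      by (subst prob_compl[symmetric]) (auto intro!: arg_cong[where f=prob])
    have "h (prob {\<omega> \<in> space M. x \<le> Z \<omega>}) = (\<integral>u. indicator {prob {\<omega> \<in> space M. Z \<omega> < x}<..} u * \<gamma> u \<partial>L01)"
      by (subst hint) (auto simp: compl)
    also have "\<dots> = (\<integral>u. indicator {u. x \<le> q u} u * \<gamma> u \<partial>L01)"
    proof (rule integral_cong_AE)
      \<comment> \<open>The two indicators can differ only at u = P(Z < x).\<close>
      show "AE u in L01. indicator {prob {\<omega> \<in> space M. Z \<omega> < x}<..} u * \<gamma> u = indicator {u. x \<le> q u} u * \<gamma> u"
        using AE_L01_countable[of "{prob {\<omega> \<in> space M. Z \<omega> < x}}", simplified] AE_space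
      proof eventually_elim
        case (elim u)
        then have "x \<le> q u \<longleftrightarrow> prob {\<omega> \<in> space M. Z \<omega> < x} < u"
          using quantile_less_imp[OF Zm, of u x] le_quantile_imp[OF Zm, of u x] unfolding q_def
          by fastforce
        then show ?case by (simp add: indicator_def)
      qed
    next
      show "(\<lambda>u. indicator {u. x \<le> q u} u * \<gamma> u) \<in> borel_measurable L01"
        using ind_int[OF S(1)] by simp
      show "(\<lambda>u. indicator {prob {\<omega> \<in> space M. Z \<omega> < x}<..} u * \<gamma> u) \<in> borel_measurable L01"
        by (rule borel_measurable_integrable[OF ind_int]) (auto simp: sets_restrict_space)
    qed
    finally show ?thesis .
  qed
  have h1: "h 1 = (\<integral>u. \<gamma> u \<partial>L01)"
    by (subst hint) (auto intro!: Bochner_Integration.integral_cong)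
  interpret LB: pair_sigma_finite L01 "lborel :: real measure" ..
  have sqp: "square_integrable L01 (\<lambda>u. max (q u) 0)" "square_integrable L01 (\<lambda>u. max (- q u) 0)"
    using square_integrable_max_zero[OF qsq] square_integrable_max_zero[OF square_integrable_cmult[OF qsq, of "-1"]]
    by simp_all
  have pos: "(LBINT x:{0..}. h (prob {\<omega> \<in> space M. x \<le> Z \<omega>})) = (\<integral>u. \<gamma> u * max (q u) 0 \<partial>L01)"
  proof -
    have "(LBINT x:{0..}. h (prob {\<omega> \<in> space M. x \<le> Z \<omega>}))
      = (\<integral>x. (\<integral>u. indicator {z\<in>space (L01 \<Otimes>\<^sub>M lborel). 0 \<le> snd z \<and> snd z \<le> q (fst z)} (u, x) * \<gamma> u \<partial>L01) \<partial>lborel)"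
      unfolding set_lebesgue_integral_def hx
      by (intro Bochner_Integration.integral_cong) (auto simp: indicator_def space_pair_measure intro!: Bochner_Integration.integral_cong)
    also have "\<dots> = (\<integral>u. \<gamma> u * max (q u) 0 \<partial>L01)"
    proof (rule LB.integral_section_swap)
      show "{z\<in>space (L01 \<Otimes>\<^sub>M lborel). 0 \<le> snd z \<and> snd z \<le> q (fst z)} \<in> sets (L01 \<Otimes>\<^sub>M lborel)"
        by measurable
      show "\<gamma> \<in> borel_measurable L01" by measurable
      show "integrable L01 (\<lambda>u. \<gamma> u * max (q u) 0)"
        by (rule integrable_mult_square_integrable[OF \<gamma> sqp(1)])
      fix u assume u: "u \<in> space L01"
      then have "Pair u -` {z\<in>space (L01 \<Otimes>\<^sub>M lborel). 0 \<le> snd z \<and> snd z \<le> q (fst z)} = {0..q u}"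
        by (auto simp: space_pair_measure)
      moreover have "emeasure lborel {0..q u} = ennreal (max (q u) 0)"
        by (cases "0 \<le> q u") (simp_all add: max_def)
      ultimately show "emeasure lborel (Pair u -` {z\<in>space (L01 \<Otimes>\<^sub>M lborel). 0 \<le> snd z \<and> snd z \<le> q (fst z)}) = ennreal (max (q u) 0)"
        by simp
    qed simp
    finally show ?thesis .
  qed
  have neg: "(LBINT x:{..0}. h (prob {\<omega> \<in> space M. x \<le> Z \<omega>}) - h 1) = - (\<integral>u. \<gamma> u * max (- q u) 0 \<partial>L01)"
  proof -
    \<comment> \<open>Subtracting h 1, the full integral of gamma, leaves the complementary set q u
      < x, whose sections in x \<le> 0 have finite length.\<close>
    have hx1: "h (prob {\<omega> \<in> space M. x \<le> Z \<omega>}) - h 1 = - (\<integral>u. indicator {u. q u < x} u * \<gamma> u \<partial>L01)" for x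
    proof -
      have "(\<integral>u. indicator {u. x \<le> q u} u * \<gamma> u \<partial>L01) + (\<integral>u. indicator {u. q u < x} u * \<gamma> u \<partial>L01)
        = (\<integral>u. indicator {u. x \<le> q u} u * \<gamma> u + indicator {u. q u < x} u * \<gamma> u \<partial>L01)"
        by (rule Bochner_Integration.integral_add[symmetric, OF ind_int[OF S(1)] ind_int[OF S(2)]])
      also have "\<dots> = (\<integral>u. \<gamma> u \<partial>L01)"
        by (intro Bochner_Integration.integral_cong) (auto simp: indicator_def)
      finally show ?thesis unfolding hx h1 by simp
    qed
    have "(LBINT x:{..0}. h (prob {\<omega> \<in> space M. x \<le> Z \<omega>}) - h 1)
      = (\<integral>x. - (\<integral>u. indicator {z\<in>space (L01 \<Otimes>\<^sub>M lborel). snd z \<le> 0 \<and> q (fst z) < snd z} (u, x) * \<gamma> u \<partial>L01) \<partial>lborel)"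
      unfolding set_lebesgue_integral_def hx1
      by (intro Bochner_Integration.integral_cong) (auto simp: indicator_def space_pair_measure intro!: Bochner_Integration.integral_cong)
    also have "\<dots> = - (\<integral>u. \<gamma> u * max (- q u) 0 \<partial>L01)"
      unfolding Bochner_Integration.integral_minus
    proof (rule arg_cong[where f=uminus], rule LB.integral_section_swap)
      show "{z\<in>space (L01 \<Otimes>\<^sub>M lborel). snd z \<le> 0 \<and> q (fst z) < snd z} \<in> sets (L01 \<Otimes>\<^sub>M lborel)"
        by measurable
      show "\<gamma> \<in> borel_measurable L01" by measurable
      show "integrable L01 (\<lambda>u. \<gamma> u * max (- q u) 0)"
        by (rule integrable_mult_square_integrable[OF \<gamma> sqp(2)])
      fix u assume u: "u \<in> space L01"
      then have "Pair u -` {z\<in>space (L01 \<Otimes>\<^sub>M lborel). snd z \<le> 0 \<and> q (fst z) < snd z} = {q u<..0}"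
        by (auto simp: space_pair_measure)
      moreover have "emeasure lborel {q u<..0} = ennreal (max (- q u) 0)"
        by (cases "q u \<le> 0") (simp_all add: max_def)
      ultimately show "emeasure lborel (Pair u -` {z\<in>space (L01 \<Otimes>\<^sub>M lborel). snd z \<le> 0 \<and> q (fst z) < snd z}) = ennreal (max (- q u) 0)"
        by simp
    qed simp
    finally show ?thesis .
  qed
  have "choquet M h Z = (\<integral>u. \<gamma> u * max (q u) 0 \<partial>L01) - (\<integral>u. \<gamma> u * max (- q u) 0 \<partial>L01)"
    unfolding choquet_def pos neg by simp
  also have "\<dots> = (\<integral>u. \<gamma> u * max (q u) 0 - \<gamma> u * max (- q u) 0 \<partial>L01)"
    using integrable_mult_square_integrable[OF \<gamma> sqp(1)] integrable_mult_square_integrable[OF \<gamma> sqp(2)]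
    by simp
  also have "\<dots> = (\<integral>u. \<gamma> u * q u \<partial>L01)"
    by (intro Bochner_Integration.integral_cong) (auto simp: max_def)
  finally show ?thesis unfolding q_def .
qed

section \<open>A uniform random variable generating a given one\<close>

text \<open>The first differing digit m changes the sum by 3^-m, and all later digits together by at
  most half of that; base 2 would allow ties.\<close>

lemma binary_expansion_base_3_inj:
  fixes a b :: "nat \<Rightarrow> bool"
  assumes eq: "(\<Sum>k. of_bool (a k) * (1/3 :: real)^k) = (\<Sum>k. of_bool (b k) * (1/3)^k)"
  shows "a = b"
proof (rule ccontr)
  assume "a \<noteq> b"
  then have ex: "\<exists>k. a k \<noteq> b k" by auto
  define m where "m = (LEAST k. a k \<noteq> b k)"
  have m: "a m \<noteq> b m" unfolding m_def using LeastI_ex[OF ex] .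
  have below: "a k = b k" if "k < m" for k using not_less_Least that unfolding m_def by blast
  have geo: "summable (\<lambda>k. (1/3 :: real)^k)" by (rule summable_geometric) simp
  have sa: "summable (\<lambda>k. of_bool (c k) * (1/3 :: real)^k)" for c :: "nat \<Rightarrow> bool"
    by (rule summable_comparison_test'[OF geo, of 0]) auto
  define d where "d k = (of_bool (a k) - of_bool (b k)) * (1/3 :: real)^k" for k
  have sd: "summable d" unfolding d_def left_diff_distrib by (intro summable_diff sa)
  have "(\<Sum>k. d k) = 0"
    unfolding d_def left_diff_distrib using suminf_diff[OF sa[of a] sa[of b]] eq by simp
  moreover have "(\<Sum>k. d k) = (\<Sum>k. d (k + Suc m)) + (\<Sum>k<Suc m. d k)"
    by (rule suminf_split_initial_segment[OF sd])
  moreover have "(\<Sum>k<Suc m. d k) = d m" using below by (simp add: d_def)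
  ultimately have "\<bar>d m\<bar> = \<bar>\<Sum>k. d (k + Suc m)\<bar>" by linarith
  also have "\<dots> \<le> (\<Sum>k. (1/3)^Suc m * (1/3 :: real)^k)"
  unfolding real_norm_def[symmetric]
  proof (rule norm_suminf_le)
    fix k
    show "norm (d (k + Suc m)) \<le> (1/3)^Suc m * (1/3)^k"
      by (auto simp: d_def power_add)
  next
    show "summable (\<lambda>k. (1/3)^Suc m * (1/3 :: real)^k)" by (intro summable_mult geo)
  qed
  also have "\<dots> = (1/3)^Suc m * (3/2)" by (subst suminf_mult[OF geo]) (simp add: suminf_geometric)
  finally have "\<bar>d m\<bar> \<le> (1/3)^m / 2" by simp
  moreover have "\<bar>d m\<bar> = (1/3)^m" using m by (auto simp: d_def)
  ultimately show False by simp
qed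

text \<open>The digits record which sets of a countable basis contain x, and in a T0 space this
  record determines x.\<close>

lemma ex_injective_borel_measurable:
  obtains s :: "'a::{second_countable_topology, t0_space} \<Rightarrow> real"
  where "s \<in> borel_measurable borel" and "inj s" and "\<And>x. 0 \<le> s x" and "\<And>x. s x \<le> 1"
proof -
  obtain B :: "'a set set" where B: "countable B" "topological_basis B"
    using ex_countable_basis by blast
  have ne: "B \<noteq> {}"
  proof
    assume "B = {}"
    then have "\<exists>B'\<subseteq>{}. \<Union>B' = (UNIV :: 'a set)" using B(2) unfolding topological_basis_def by (metis open_UNIV)
    then show False by auto
  qed
  define A where "A = from_nat_into B"
  have rA: "range A = B" unfolding A_def using range_from_nat_into[OF ne B(1)] .
  define t where "t x = (\<Sum>k. of_bool (x \<in> A k) * (1/3 :: real)^k)" for x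
  have geo: "summable (\<lambda>k. (1/3 :: real)^k)" by (rule summable_geometric) simp
  have sm: "summable (\<lambda>k. of_bool (x \<in> A k) * (1/3 :: real)^k)" for x
    by (rule summable_comparison_test'[OF geo, of 0]) auto
  have t0: "0 \<le> t x" for x unfolding t_def by (intro suminf_nonneg sm) auto
  have "t x \<le> (\<Sum>k. (1/3)^k)" for x unfolding t_def by (intro suminf_le sm geo) auto
  then have t2: "t x \<le> 3/2" for x by (simp add: suminf_geometric)
  have "inj t"
  proof (rule injI, rule ccontr)
    fix x y assume eq: "t x = t y" and "x \<noteq> y"
    then obtain V where V: "open V" "\<not> (x \<in> V \<longleftrightarrow> y \<in> V)"
      using separation_t0[of x y] by blast
    have "(\<lambda>k. x \<in> A k) = (\<lambda>k. y \<in> A k)"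
      using eq unfolding t_def by (rule binary_expansion_base_3_inj)
    then have Ak: "x \<in> A k \<longleftrightarrow> y \<in> A k" for k by (rule fun_cong)
    have same: "x \<in> C \<longleftrightarrow> y \<in> C" if "C \<in> B" for C
    proof -
      have "C \<in> range A" using that rA by simp
      then obtain k where "C = A k" by (rule rangeE)
      then show ?thesis using Ak by simp
    qed
    obtain B' where "B' \<subseteq> B" "\<Union>B' = V" using B(2) V(1) unfolding topological_basis_def by blast
    then show False using same V(2) by blast
  qed
  moreover have "t \<in> borel_measurable borel"
  proof -
    have [measurable]: "A k \<in> sets borel" for k
    proof -
      have "A k \<in> B" using rA rangeI[of A k] by simp
      then show ?thesis using topological_basis_open[OF B(2)] by (intro borel_open)
    qed
    show ?thesis unfolding t_def of_bool_def by measurable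
  qed
  \<comment> \<open>The series is bounded by 3/2, so halving it puts the values into [0, 1].\<close>
  moreover have "t x / 2 \<le> 1" for x using t2[of x] by simp
  ultimately show ?thesis
    using t0 by (intro that[of "\<lambda>x. t x / 2"]) (auto simp: inj_def)
qed

lemma nonatomic_emeasure_singleton:
  assumes "nonatomic M"
  shows "emeasure M {x} = 0"
proof (rule ccontr)
  assume "emeasure M {x} \<noteq> 0"
  then have "0 < emeasure M {x}" "{x} \<in> sets M" by (auto simp: zero_less_iff_neq_zero intro: ccontr dest: emeasure_notin_sets)
  then obtain B where "B \<subseteq> {x}" "0 < emeasure M B" "emeasure M B < emeasure M {x}"
    using assms unfolding nonatomic_def by blast
  then show False by (cases "B = {}") (auto simp: subset_singleton_iff)
qed

text \<open>Probability integral transform: without atoms the distribution function is continuous,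
  so composing it with the quantile function gives exactly u.\<close>

lemma (in prob_space) distr_cdf_transform:
  fixes W :: "'a \<Rightarrow> real"
  assumes W [measurable]: "W \<in> borel_measurable M" and atomless: "\<And>w. prob {\<omega>\<in>space M. W \<omega> = w} = 0"
  shows "distr M borel (\<lambda>\<omega>. prob {\<omega>'\<in>space M. W \<omega>' \<le> W \<omega>}) = distr L01 borel (\<lambda>u. u)"
proof -
  interpret D: cdf_distribution "distr M borel W"
    unfolding cdf_distribution_def using W by (rule real_distribution_distr)
  let ?F = "cdf (distr M borel W)"
  have F: "?F x = prob {\<omega>\<in>space M. W \<omega> \<le> x}" for x
    by (auto simp: cdf_def measure_distr intro!: arg_cong[where f=prob])
  have cont: "isCont ?F x" for x
  proof -
    have "measure (distr M borel W) {x} = 0"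
      using atomless[of x] by (simp add: measure_distr vimage_def Int_def conj_commute)
    then show ?thesis by (simp add: D.isCont_cdf)
  qed
  have inv: "?F (quantile M W u) = u" if u: "u \<in> {0<..<1}" for u
  proof (rule antisym)
    show "u \<le> ?F (quantile M W u)" using quantile_le_iff[OF W u, of "quantile M W u"] F by simp
    have "(?F \<longlongrightarrow> ?F (quantile M W u)) (at_left (quantile M W u))"
      using cont[of "quantile M W u"] by (auto simp: isCont_def filterlim_at_split)
    moreover have "eventually (\<lambda>x. ?F x \<le> u) (at_left (quantile M W u))"
    proof (rule eventually_at_leftI[of "quantile M W u - 1"])
      fix x assume "x \<in> {quantile M W u - 1<..<quantile M W u}"
      then show "?F x \<le> u" using quantile_le_iff[OF W u, of x] F by auto
    qed simp
    ultimately show "?F (quantile M W u) \<le> u"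
      by (intro tendsto_upperbound[of ?F _ "at_left (quantile M W u)"]) auto
  qed
  have Fm: "?F \<in> borel_measurable borel" by (rule D.measurable_C)
  have "distr M borel (\<lambda>\<omega>. prob {\<omega>'\<in>space M. W \<omega>' \<le> W \<omega>}) = distr (distr M borel W) borel ?F"
    using Fm by (subst distr_distr) (auto simp: F comp_def)
  also have "\<dots> = distr L01 borel (\<lambda>u. ?F (quantile M W u))"
    using distr_distr[OF Fm measurable_quantile[OF W]] by (simp add: distr_quantile[OF W] comp_def)
  also have "\<dots> = distr L01 borel (\<lambda>u. u)"
    by (rule distr_cong) (auto simp: inv)
  finally show ?thesis .
qed

lemma AE_eq_of_le_of_integral_eq:
  fixes f g :: "'a \<Rightarrow> real"
  assumes f: "integrable M f" and g: "integrable M g" and le: "AE x in M. f x \<le> g x"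
    and eq: "(\<integral>x. f x \<partial>M) = (\<integral>x. g x \<partial>M)"
  shows "AE x in M. f x = g x"
proof -
  have "AE x in M. 0 \<le> g x - f x" using le by eventually_elim simp
  moreover have "(\<integral>x. g x - f x \<partial>M) = 0" using f g eq by simp
  ultimately have "AE x in M. g x - f x = 0"
    using integral_nonneg_eq_0_iff_AE[of M "\<lambda>x. g x - f x"] f g by simp
  then show ?thesis by eventually_elim simp
qed

text \<open>Breaking the ties of \<open>Z\<close> with an injective map \<open>s\<close> gives an atomless \<open>W\<close> of which \<open>Z\<close> is a
  monotone function; the distribution function of \<open>W\<close> then turns \<open>W\<close> into a uniform variable.\<close>

lemma ex_uniform_representation:
  fixes P :: "'a::{second_countable_topology, t0_space} measure" and Z :: "'a \<Rightarrow> real"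
  assumes P: "prob_space P" and sets: "sets P = sets borel" and na: "nonatomic P"
    and Z: "square_integrable P Z"
  obtains U where "U \<in> borel_measurable P" and "distr P borel U = distr L01 borel (\<lambda>u. u)"
    and "AE \<omega> in P. U \<omega> \<in> {0<..<1} \<and> quantile P Z (U \<omega>) = Z \<omega>"
proof -
  interpret prob_space P by (rule P)
  have Zm [measurable]: "Z \<in> borel_measurable P" using Z by (simp add: square_integrable_real)
  have sp: "space P = UNIV" using sets_eq_imp_space_eq[OF sets] by simp
  obtain s :: "'a \<Rightarrow> real" where s: "s \<in> borel_measurable borel" "inj s" "\<And>x. 0 \<le> s x" "\<And>x. s x \<le> 1"
    using ex_injective_borel_measurable by blast
  have sm [measurable]: "s \<in> borel_measurable P" using s(1) measurable_cong_sets[OF sets refl] by blast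
  define F where "F z = prob {\<omega>\<in>space P. Z \<omega> \<le> z}" for z
  define G where "G z = prob {\<omega>\<in>space P. Z \<omega> < z}" for z
  have "mono F" "mono G"
    unfolding F_def G_def by (auto intro!: monoI finite_measure_mono)
  then have [measurable]: "F \<in> borel_measurable borel" "G \<in> borel_measurable borel"
    by (auto intro: borel_measurable_mono)
  have FG: "F z - G z = prob {\<omega>\<in>space P. Z \<omega> = z}" for z
  proof -
    have "F z = prob ({\<omega>\<in>space P. Z \<omega> < z} \<union> {\<omega>\<in>space P. Z \<omega> = z})"
      unfolding F_def by (rule arg_cong[where f=prob]) auto
    also have "\<dots> = G z + prob {\<omega>\<in>space P. Z \<omega> = z}"
      unfolding G_def by (intro finite_measure_Union) auto
    finally show ?thesis by simp
  qed
  have GF: "G z \<le> F z" for z using FG[of z] measure_nonneg[of P "{\<omega>\<in>space P. Z \<omega> = z}"] by linarith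
  have FG': "F z \<le> G z'" if "z < z'" for z z'
    unfolding F_def G_def using that by (intro finite_measure_mono) auto
  \<comment> \<open>What is added to Z lies between G(Z) and F(Z), the two ends of the jump of the
    distribution function at Z, so it never reverses the order of Z. The summand Z keeps the order
    strict where the distribution function is flat.\<close>
  define W where "W \<omega> = Z \<omega> + G (Z \<omega>) + (F (Z \<omega>) - G (Z \<omega>)) * s \<omega>" for \<omega>
  have Wm [measurable]: "W \<in> borel_measurable P" unfolding W_def by measurable
  have W_mono: "W \<omega> < W \<omega>'" if "Z \<omega> < Z \<omega>'" for \<omega> \<omega>'
  proof -
    have "(F (Z \<omega>) - G (Z \<omega>)) * s \<omega> \<le> F (Z \<omega>) - G (Z \<omega>)"
      using mult_left_le[OF s(4), of "F (Z \<omega>) - G (Z \<omega>)" \<omega>] GF[of "Z \<omega>"] by simp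
    moreover have "0 \<le> (F (Z \<omega>') - G (Z \<omega>')) * s \<omega>'"
      using GF[of "Z \<omega>'"] s(3) by (intro mult_nonneg_nonneg) auto
    ultimately show ?thesis using FG'[OF that] that unfolding W_def by linarith
  qed
  have atomless: "prob {\<omega>\<in>space P. W \<omega> = w} = 0" for w
  proof (cases "\<exists>\<omega>0. W \<omega>0 = w")
    case True
    then obtain \<omega>0 where \<omega>0: "W \<omega>0 = w" by blast
    have same: "Z \<omega> = Z \<omega>0" if "W \<omega> = w" for \<omega>
      using W_mono[of \<omega> \<omega>0] W_mono[of \<omega>0 \<omega>] that \<omega>0
      by (cases "Z \<omega>" "Z \<omega>0" rule: linorder_cases) auto
    show ?thesis
    proof (cases "F (Z \<omega>0) - G (Z \<omega>0) = 0")
      case True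
      have "prob {\<omega>\<in>space P. W \<omega> = w} \<le> prob {\<omega>\<in>space P. Z \<omega> = Z \<omega>0}"
        using same by (intro finite_measure_mono) auto
      then show ?thesis using True FG[of "Z \<omega>0"] measure_nonneg[of P "{\<omega>\<in>space P. W \<omega> = w}"] by linarith
    next
      case False
      \<comment> \<open>On an atom of Z, injectivity of s leaves a single sample point, which is
        null by non-atomicity.\<close>
      have "\<omega> = \<omega>0" if "W \<omega> = w" for \<omega>
      proof -
        have "s \<omega> = s \<omega>0" using that \<omega>0 same[OF that] False unfolding W_def by auto
        then show ?thesis using s(2) by (simp add: inj_eq)
      qed
      then have "{\<omega>\<in>space P. W \<omega> = w} = {\<omega>0}" unfolding sp using \<omega>0 by blast
      then show ?thesis using nonatomic_emeasure_singleton[OF na] by (simp add: measure_def)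
    qed
  qed auto
  define U where "U \<omega> = prob {\<omega>'\<in>space P. W \<omega>' \<le> W \<omega>}" for \<omega>
  have "mono (\<lambda>w. prob {\<omega>'\<in>space P. W \<omega>' \<le> w})"
    by (auto intro!: monoI finite_measure_mono)
  then have [measurable]: "(\<lambda>w. prob {\<omega>'\<in>space P. W \<omega>' \<le> w}) \<in> borel_measurable borel"
    by (rule borel_measurable_mono)
  have Um [measurable]: "U \<in> borel_measurable P" unfolding U_def by measurable
  have dU: "distr P borel U = distr L01 borel (\<lambda>u. u)"
    unfolding U_def by (rule distr_cdf_transform[OF Wm atomless])
  have idm: "(\<lambda>u. u) \<in> borel_measurable L01"
    by (rule mono_on_measurable_L01) (auto simp: mono_on_def)
  have U01: "AE \<omega> in P. U \<omega> \<in> {0<..<1}"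
  proof -
    have "AE u in distr L01 borel (\<lambda>u. u). u \<in> {0<..<1::real}"
      by (subst AE_distr_iff[OF idm]) (auto intro!: AE_I2)
    then show ?thesis unfolding dU[symmetric] by (subst (asm) AE_distr_iff) auto
  qed
  \<comment> \<open>The zero extension is Borel on the whole line and can be composed with
    \<open>U\<close>, which lies in (0,1) only almost surely.\<close>
  define Q where "Q u = (if u \<in> {0<..<1} then quantile P Z u else 0)" for u
  have Qm [measurable]: "Q \<in> borel_measurable borel"
  proof -
    have "quantile P Z \<in> borel_measurable (restrict_space borel {0<..<1})"
      by (rule borel_measurable_mono_on_fnc[OF mono_on_quantile[OF Zm]])
    then show ?thesis
      unfolding Q_def by (subst (asm) measurable_restrict_space_iff[where c=0]) auto
  qed
  \<comment> \<open>Only this inequality is direct; equality follows because both sides have the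
    same mean.\<close>
  have QZ: "AE \<omega> in P. Q (U \<omega>) \<le> Z \<omega>"
    using U01
  proof eventually_elim
    case (elim \<omega>)
    have "U \<omega> \<le> prob {\<omega>'\<in>space P. Z \<omega>' \<le> Z \<omega>}"
      unfolding U_def
    proof (rule finite_measure_mono)
      show "{\<omega>'\<in>space P. W \<omega>' \<le> W \<omega>} \<subseteq> {\<omega>'\<in>space P. Z \<omega>' \<le> Z \<omega>}"
        using W_mono[of \<omega>] by (auto simp: not_less[symmetric])
    qed measurable
    then show ?case using quantile_le_iff[OF Zm elim, of "Z \<omega>"] elim by (simp add: Q_def)
  qed
  have intZ: "integrable P Z" by (rule integrable_of_square_integrable[OF Z])
  have "integrable L01 (quantile P Z)" using integrable_quantile_iff[OF Zm, of "\<lambda>x. x"] intZ by simp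
  then have intQ: "integrable L01 Q"
    by (subst Bochner_Integration.integrable_cong[OF refl]) (auto simp: Q_def)
  have intQU: "integrable P (\<lambda>\<omega>. Q (U \<omega>))"
    using intQ integrable_distr_eq[OF Um Qm] integrable_distr_eq[OF idm Qm] dU by simp
  have "(\<integral>\<omega>. Q (U \<omega>) \<partial>P) = (\<integral>u. Q u \<partial>L01)"
    using integral_distr[OF Um Qm] integral_distr[OF idm Qm] dU by simp
  also have "\<dots> = (\<integral>u. quantile P Z u \<partial>L01)"
    by (intro Bochner_Integration.integral_cong) (auto simp: Q_def)
  also have "\<dots> = (\<integral>\<omega>. Z \<omega> \<partial>P)" using integral_quantile[OF Zm, of "\<lambda>x. x"] by simp
  finally have "AE \<omega> in P. Q (U \<omega>) = Z \<omega>"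
    by (intro AE_eq_of_le_of_integral_eq intQU intZ QZ)
  then have "AE \<omega> in P. U \<omega> \<in> {0<..<1} \<and> quantile P Z (U \<omega>) = Z \<omega>"
    using U01 by eventually_elim (simp add: Q_def)
  with Um dU show ?thesis by (rule that)
qed

text \<open>Indeed \<open>j\<close> dominates the quantile function and has the same mean.\<close>

lemma (in prob_space) quantile_AE_eq_of_distr:
  assumes V [measurable]: "V \<in> borel_measurable M" and j: "mono_on {0<..<1} j"
    and sq: "square_integrable L01 j" and d: "distr M borel V = distr L01 borel j"
  shows "AE u in L01. quantile M V u = j u"
proof (rule AE_eq_of_le_of_integral_eq)
  note jm [measurable] = mono_on_measurable_L01[OF j]
  show "integrable L01 j" by (rule L01.integrable_of_square_integrable[OF sq])
  then have intV: "integrable M V"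
    using integrable_distr_eq[OF V, of "\<lambda>x. x"] integrable_distr_eq[OF jm, of "\<lambda>x. x"] d by simp
  then show "integrable L01 (quantile M V)" using integrable_quantile_iff[OF V, of "\<lambda>x. x"] by simp
  have "(\<integral>u. quantile M V u \<partial>L01) = (\<integral>\<omega>. V \<omega> \<partial>M)" using integral_quantile[OF V, of "\<lambda>x. x"] by simp
  also have "\<dots> = (\<integral>u. j u \<partial>L01)"
    using integral_distr[OF V, of "\<lambda>x. x"] integral_distr[OF jm, of "\<lambda>x. x"] d by simp
  finally show "(\<integral>u. quantile M V u \<partial>L01) = (\<integral>u. j u \<partial>L01)" .
  show "AE u in L01. quantile M V u \<le> j u"
  proof (rule AE_I2)
    fix u assume "u \<in> space L01"
    then have u: "u \<in> {0<..<1}" by simp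
    have "u = measure L01 {0<..<u}" using u by (subst measure_restrict_space) auto
    also have "\<dots> \<le> measure L01 (j -` {..j u} \<inter> space L01)"
    proof (rule L01.finite_measure_mono)
      show "{0<..<u} \<subseteq> j -` {..j u} \<inter> space L01" using u j by (auto simp: mono_on_def)
    qed measurable
    also have "\<dots> = measure (distr M borel V) {..j u}" unfolding d by (subst measure_distr) auto
    also have "\<dots> = prob {\<omega>\<in>space M. V \<omega> \<le> j u}"
      by (subst measure_distr) (auto intro!: arg_cong[where f=prob])
    finally show "quantile M V u \<le> j u" using quantile_le_iff[OF V u] by simp
  qed
qed

section \<open>Wasserstein balls\<close>

lemma distr_pair_in_couplings:
  fixes X Y :: "'a \<Rightarrow> 'b::euclidean_space"
  assumes "prob_space P" and [measurable]: "X \<in> borel_measurable P" "Y \<in> borel_measurable P"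
  shows "distr P borel (\<lambda>\<omega>. (Y \<omega>, X \<omega>)) \<in> couplings (distr P borel Y) (distr P borel X)"
proof -
  interpret prob_space P by fact
  have "fst \<in> borel_measurable (borel :: ('b \<times> 'b) measure)" "snd \<in> borel_measurable (borel :: ('b \<times> 'b) measure)"
    by (auto intro!: borel_measurable_continuous_onI continuous_intros)
  then show ?thesis
    unfolding couplings_def by (auto simp: distr_distr comp_def intro: prob_space_distr)
qed

text \<open>The law of (Y, X) is itself a coupling, and its cost bounds the infimum.\<close>

lemma wasserstein_ballI:
  fixes X Y :: "'a \<Rightarrow> 'b::euclidean_space"
  assumes P: "prob_space P" and X: "square_integrable P X" and Y: "square_integrable P Y"
    and \<epsilon>: "0 \<le> \<epsilon>" and le: "(\<integral>\<omega>. (norm (Y \<omega> - X \<omega>))\<^sup>2 \<partial>P) \<le> \<epsilon>\<^sup>2"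
  shows "Y \<in> wasserstein_ball P X \<epsilon>"
proof -
  interpret prob_space P by (rule P)
  have [measurable]: "X \<in> borel_measurable P" "Y \<in> borel_measurable P"
    using X Y by (auto simp: square_integrable_def)
  define \<pi> where "\<pi> = distr P borel (\<lambda>\<omega>. (Y \<omega>, X \<omega>))"
  have "\<pi> \<in> couplings (distr P borel Y) (distr P borel X)"
    unfolding \<pi>_def by (intro distr_pair_in_couplings P) measurable
  moreover have "(\<integral>z. (norm (fst z - snd z))\<^sup>2 \<partial>\<pi>) = (\<integral>\<omega>. (norm (Y \<omega> - X \<omega>))\<^sup>2 \<partial>P)"
    unfolding \<pi>_def
    by (subst integral_distr) (auto intro!: borel_measurable_continuous_onI continuous_intros)
  ultimately have "(INF \<pi>\<in>couplings (distr P borel Y) (distr P borel X). \<integral>z. (norm (fst z - snd z))\<^sup>2 \<partial>\<pi>) \<le> \<epsilon>\<^sup>2"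
    using le by (intro cINF_lower2[of _ _ \<pi>]) (auto intro: bdd_belowI2[of _ 0])
  then have "wasserstein2 (distr P borel Y) (distr P borel X) \<le> sqrt (\<epsilon>\<^sup>2)"
    unfolding wasserstein2_def by (rule real_sqrt_le_mono)
  then show ?thesis using Y \<epsilon> by (simp add: wasserstein_ball_def)
qed

lemma square_integrable_comp_lipschitz:
  fixes Y :: "'a \<Rightarrow> 'b::euclidean_space" and g :: "'b \<Rightarrow> real"
  assumes P: "prob_space P" and Y: "square_integrable P Y" and g: "K-lipschitz_on UNIV g"
  shows "square_integrable P (g \<circ> Y)"
proof -
  interpret prob_space P by (rule P)
  have "continuous_on UNIV g" by (rule lipschitz_on_continuous_on[OF g])
  then have [measurable]: "g \<in> borel_measurable borel" by (rule borel_measurable_continuous_onI)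
  have [measurable]: "Y \<in> borel_measurable P" using Y by (simp add: square_integrable_def)
  have bd: "(g (Y \<omega>) - g 0)\<^sup>2 \<le> K\<^sup>2 * (norm (Y \<omega>))\<^sup>2" for \<omega>
  proof -
    have "\<bar>g (Y \<omega>) - g 0\<bar> \<le> K * norm (Y \<omega>)"
      using lipschitz_onD[OF g, of "Y \<omega>" 0] by (simp add: dist_norm)
    then have "\<bar>g (Y \<omega>) - g 0\<bar>\<^sup>2 \<le> (K * norm (Y \<omega>))\<^sup>2" by (rule power_mono) simp
    then show ?thesis by (simp add: power_mult_distrib)
  qed
  have "integrable P (\<lambda>\<omega>. (g (Y \<omega>) - g 0)\<^sup>2)"
    by (rule Bochner_Integration.integrable_bound[where f="\<lambda>\<omega>. K\<^sup>2 * (norm (Y \<omega>))\<^sup>2"])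
      (use Y bd in \<open>auto simp: square_integrable_def\<close>)
  then have "square_integrable P (\<lambda>\<omega>. g (Y \<omega>) - g 0)" by (simp add: square_integrable_real)
  from square_integrable_add[OF this square_integrable_const[of "g 0"]]
  show ?thesis by (simp add: comp_def)
qed

lemma quantile_cong_distr:
  assumes "distr M borel A = distr N borel B"
  shows "quantile M A = quantile N B"
  using assms by (simp add: quantile_def fun_eq_iff)

text \<open>Quantile functions depend on laws only, so they may be computed on the coupling itself,
  with g of the two coordinates in place of g(Y) and g(X). There optimality of the comonotone
  coupling and the pointwise Lipschitz bound apply.\<close>

lemma quantile_distance_coupling:
  fixes X Y :: "'a \<Rightarrow> 'b::euclidean_space" and g :: "'b \<Rightarrow> real"
  assumes X: "square_integrable P X" and Y: "square_integrable P Y" and g: "K-lipschitz_on UNIV g"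
    and \<pi>: "\<pi> \<in> couplings (distr P borel Y) (distr P borel X)"
    and sq: "square_integrable L01 (quantile P (g \<circ> X))" "square_integrable L01 (quantile P (g \<circ> Y))"
  shows "(\<integral>u. (quantile P (g \<circ> X) u - quantile P (g \<circ> Y) u)\<^sup>2 \<partial>L01)
    \<le> K\<^sup>2 * (\<integral>z. (norm (fst z - snd z))\<^sup>2 \<partial>\<pi>)"
proof -
  interpret \<pi>: prob_space \<pi> using \<pi> by (simp add: couplings_def)
  have sets: "sets \<pi> = sets borel" and fst: "distr \<pi> borel fst = distr P borel Y"
    and snd: "distr \<pi> borel snd = distr P borel X" using \<pi> by (auto simp: couplings_def)
  have Xm [measurable]: "X \<in> borel_measurable P" and Ym [measurable]: "Y \<in> borel_measurable P"
    using X Y by (auto simp: square_integrable_def)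
  have "continuous_on UNIV g" by (rule lipschitz_on_continuous_on[OF g])
  then have gm [measurable]: "g \<in> borel_measurable borel" by (rule borel_measurable_continuous_onI)
  have fm: "fst \<in> borel_measurable \<pi>" and sm: "snd \<in> borel_measurable \<pi>"
    unfolding measurable_cong_sets[OF sets refl]
    by (auto intro!: borel_measurable_continuous_onI continuous_intros)
  have q: "quantile P (g \<circ> X) = quantile \<pi> (g \<circ> snd)" "quantile P (g \<circ> Y) = quantile \<pi> (g \<circ> fst)"
    by (rule quantile_cong_distr,
        simp only: distr_distr[OF gm Xm, symmetric] distr_distr[OF gm Ym, symmetric]
          distr_distr[OF gm fm, symmetric] distr_distr[OF gm sm, symmetric] fst snd)+
  have "square_integrable \<pi> fst"
    using integrable_distr_eq[OF fm, of "\<lambda>x. (norm x)\<^sup>2"] integrable_distr_eq[OF Ym, of "\<lambda>x. (norm x)\<^sup>2"] Y fm fst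
    by (simp add: square_integrable_def)
  moreover have "square_integrable \<pi> snd"
    using integrable_distr_eq[OF sm, of "\<lambda>x. (norm x)\<^sup>2"] integrable_distr_eq[OF Xm, of "\<lambda>x. (norm x)\<^sup>2"] X sm snd
    by (simp add: square_integrable_def)
  ultimately have int: "integrable \<pi> (\<lambda>z. (norm (fst z - snd z))\<^sup>2)"
    using square_integrable_diff[of \<pi> fst snd] by (simp add: square_integrable_def)
  have A: "g \<circ> snd \<in> borel_measurable \<pi>" and B: "g \<circ> fst \<in> borel_measurable \<pi>"
    using measurable_comp[OF sm gm] measurable_comp[OF fm gm] by auto
  have "ennreal (\<integral>u. (quantile P (g \<circ> X) u - quantile P (g \<circ> Y) u)\<^sup>2 \<partial>L01)
    = (\<integral>\<^sup>+u. ennreal ((quantile \<pi> (g \<circ> snd) u - quantile \<pi> (g \<circ> fst) u)\<^sup>2) \<partial>L01)"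
    using square_integrable_diff[OF sq] unfolding q[symmetric]
    by (intro nn_integral_eq_integral[symmetric]) (auto simp: square_integrable_real)
  also have "\<dots> \<le> (\<integral>\<^sup>+z. ennreal (((g \<circ> snd) z - (g \<circ> fst) z)\<^sup>2) \<partial>\<pi>)"
    by (rule \<pi>.quantile_coupling_optimal[OF A B])
  also have "\<dots> \<le> (\<integral>\<^sup>+z. ennreal (K\<^sup>2 * (norm (fst z - snd z))\<^sup>2) \<partial>\<pi>)"
  proof (intro nn_integral_mono ennreal_leI)
    fix z :: "'b \<times> 'b"
    have "\<bar>g (snd z) - g (fst z)\<bar> \<le> K * norm (fst z - snd z)"
      using lipschitz_onD[OF g, of "snd z" "fst z"] by (simp add: dist_norm norm_minus_commute)
    then have "\<bar>g (snd z) - g (fst z)\<bar>\<^sup>2 \<le> (K * norm (fst z - snd z))\<^sup>2" by (rule power_mono) simp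
    then show "((g \<circ> snd) z - (g \<circ> fst) z)\<^sup>2 \<le> K\<^sup>2 * (norm (fst z - snd z))\<^sup>2"
      by (simp add: power_mult_distrib)
  qed
  also have "\<dots> = ennreal (K\<^sup>2 * (\<integral>z. (norm (fst z - snd z))\<^sup>2 \<partial>\<pi>))"
    using int by (subst nn_integral_eq_integral) auto
  finally show ?thesis by (subst (asm) ennreal_le_iff) auto
qed

text \<open>The bound holds for every coupling; divided by K^2 it passes to the infimum, whether or
  not that is attained.\<close>

lemma quantile_distance_wasserstein_ball:
  fixes X Y :: "'a \<Rightarrow> 'b::euclidean_space" and g :: "'b \<Rightarrow> real"
  assumes P: "prob_space P" and X: "square_integrable P X" and Y: "Y \<in> wasserstein_ball P X \<epsilon>"
    and g: "K-lipschitz_on UNIV g" and K: "0 < K"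
  shows "(\<integral>u. (quantile P (g \<circ> X) u - quantile P (g \<circ> Y) u)\<^sup>2 \<partial>L01) \<le> K\<^sup>2 * \<epsilon>\<^sup>2"
proof -
  interpret prob_space P by (rule P)
  have Ysq: "square_integrable P Y" and W: "wasserstein2 (distr P borel Y) (distr P borel X) \<le> \<epsilon>"
    using Y by (auto simp: wasserstein_ball_def)
  have [measurable]: "X \<in> borel_measurable P" "Y \<in> borel_measurable P"
    using X Ysq by (auto simp: square_integrable_def)
  define I where "I = (\<integral>u. (quantile P (g \<circ> X) u - quantile P (g \<circ> Y) u)\<^sup>2 \<partial>L01)"
  define C where "C = couplings (distr P borel Y) (distr P borel X)"
  have "distr P borel (\<lambda>\<omega>. (Y \<omega>, X \<omega>)) \<in> C"
    unfolding C_def by (intro distr_pair_in_couplings P) measurable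
  then have ne: "C \<noteq> {}" by blast
  have "I / K\<^sup>2 \<le> (INF \<pi>\<in>C. \<integral>z. (norm (fst z - snd z))\<^sup>2 \<partial>\<pi>)"
  proof (rule cINF_greatest[OF ne])
    fix \<pi> assume "\<pi> \<in> C"
    then have "I \<le> K\<^sup>2 * (\<integral>z. (norm (fst z - snd z))\<^sup>2 \<partial>\<pi>)"
      unfolding I_def C_def
      by (rule quantile_distance_coupling[OF X Ysq g])
        (use square_integrable_quantile square_integrable_comp_lipschitz[OF P _ g] X Ysq in blast)+
    then show "I / K\<^sup>2 \<le> (\<integral>z. (norm (fst z - snd z))\<^sup>2 \<partial>\<pi>)"
      using K by (simp add: divide_le_eq mult.commute)
  qed
  also have "\<dots> \<le> \<epsilon>\<^sup>2"
    using W unfolding wasserstein2_def C_def[symmetric] by (rule sqrt_le_D)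
  finally show ?thesis using K unfolding I_def[symmetric] by (simp add: divide_le_eq mult.commute)
qed

section \<open>Attaining monotone quantile functions along the linear component\<close>

text \<open>\<beta> vanishes on \<open>J\<close>, so moving along it leaves the argument of
  \<open>g'\<close> fixed; the rate is \<beta> paired with itself.\<close>

lemma linear_decomposition_shift:
  assumes "linear_decomposition g J g' \<beta>"
  shows "g (x + c *\<^sub>R \<beta>) = g x + c * (norm \<beta>)\<^sup>2"
proof -
  have \<beta>: "\<beta> $ i = 0" if "i \<in> J" for i
    using assms that by (auto simp: linear_decomposition_def coord_subspace_def)
  have "coord_proj J (x + c *\<^sub>R \<beta>) = coord_proj J x"
    using \<beta> by (auto simp: coord_proj_def vec_eq_iff)
  moreover have "coord_proj (- J) (x + c *\<^sub>R \<beta>) = coord_proj (- J) x + c *\<^sub>R \<beta>"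
    using \<beta> by (auto simp: coord_proj_def vec_eq_iff)
  ultimately show ?thesis
    using assms by (simp add: linear_decomposition_def inner_add_right power2_norm_eq_inner)
qed

lemma wasserstein_ball_realizes_quantile:
  fixes P :: "(real ^ 'n::finite) measure"
  assumes P: "prob_space P" and sets: "sets P = sets borel" and na: "nonatomic P"
    and g: "K-lipschitz_on UNIV g" and dec: "linear_decomposition g J g' \<beta>"
    and X: "square_integrable P X" and \<epsilon>: "0 \<le> \<epsilon>"
    and j: "mono_on {0<..<1} j" and jsq: "square_integrable L01 j"
    and dist: "(\<integral>u. (j u - quantile P (g \<circ> X) u)\<^sup>2 \<partial>L01) \<le> (norm \<beta>)\<^sup>2 * \<epsilon>\<^sup>2"
  obtains Y where "Y \<in> wasserstein_ball P X \<epsilon>" and "AE u in L01. quantile P (g \<circ> Y) u = j u"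
proof (cases "\<beta> = 0")
  \<comment> \<open>The radius is zero, so j agrees with the quantile function of g(X) almost
    everywhere and X itself will do.\<close>
  case True
  interpret prob_space P by (rule P)
  define q where "q = quantile P (g \<circ> X)"
  have "square_integrable L01 q"
    unfolding q_def by (rule square_integrable_quantile[OF square_integrable_comp_lipschitz[OF P X g]])
  from square_integrable_diff[OF jsq this] have int: "integrable L01 (\<lambda>u. (j u - q u)\<^sup>2)"
    by (simp add: square_integrable_real)
  have "(\<integral>u. (j u - q u)\<^sup>2 \<partial>L01) = 0"
    using dist True unfolding q_def by (intro antisym) auto
  then have "AE u in L01. (j u - q u)\<^sup>2 = 0"
    using integral_nonneg_eq_0_iff_AE[OF int] by simp
  then have "AE u in L01. q u = j u" by eventually_elim simp
  moreover have "X \<in> wasserstein_ball P X \<epsilon>"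
    by (rule wasserstein_ballI[OF P X X \<epsilon>]) simp
  ultimately show ?thesis using that unfolding q_def by blast
next
  case False
  interpret prob_space P by (rule P)
  have Xm [measurable]: "X \<in> borel_measurable P" using X by (simp add: square_integrable_def)
  define q where "q = quantile P (g \<circ> X)"
  note gX = square_integrable_comp_lipschitz[OF P X g]
  have gXm: "g \<circ> X \<in> borel_measurable P" using gX by (simp add: square_integrable_real)
  note qm = mono_on_quantile[OF gXm, folded q_def]
  note qsq = square_integrable_quantile[OF gX, folded q_def]
  obtain U where Um [measurable]: "U \<in> borel_measurable P" and dU: "distr P borel U = distr L01 borel (\<lambda>u. u)"
    and U: "AE \<omega> in P. U \<omega> \<in> {0<..<1} \<and> q (U \<omega>) = (g \<circ> X) \<omega>"
    using ex_uniform_representation[OF P sets na gX] unfolding q_def by blast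
  have idm: "(\<lambda>u. u) \<in> borel_measurable L01"
    by (rule mono_on_measurable_L01) (auto simp: mono_on_def)
  have ext: "(\<lambda>u. if u \<in> {0<..<1} then f u else 0) \<in> borel_measurable borel"
    if "mono_on {0<..<1} f" for f :: "real \<Rightarrow> real"
    using borel_measurable_mono_on_fnc[OF that]
    by (subst (asm) measurable_restrict_space_iff[where c=0]) auto
  \<comment> \<open>Both functions are controlled on (0,1) only; their zero extensions are Borel on
    the line.\<close>
  define j0 q0 where "j0 u = (if u \<in> {0<..<1} then j u else 0)"
    and "q0 u = (if u \<in> {0<..<1} then q u else 0)" for u
  have j0m [measurable]: "j0 \<in> borel_measurable borel" and q0m [measurable]: "q0 \<in> borel_measurable borel"
    using ext[OF j] ext[OF qm] unfolding j0_def q0_def by auto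
  define D where "D u = j0 u - q0 u" for u
  have Dm [measurable]: "D \<in> borel_measurable borel" unfolding D_def by measurable
  have D_int: "integrable L01 (\<lambda>u. (D u)\<^sup>2)" and D_eq: "(\<integral>u. (D u)\<^sup>2 \<partial>L01) = (\<integral>u. (j u - q u)\<^sup>2 \<partial>L01)"
  proof -
    have "integrable L01 (\<lambda>u. (j u - q u)\<^sup>2)"
      using square_integrable_diff[OF jsq qsq] by (simp add: square_integrable_real)
    then show "integrable L01 (\<lambda>u. (D u)\<^sup>2)"
      by (subst Bochner_Integration.integrable_cong[OF refl]) (auto simp: D_def j0_def q0_def)
    show "(\<integral>u. (D u)\<^sup>2 \<partial>L01) = (\<integral>u. (j u - q u)\<^sup>2 \<partial>L01)"
      by (intro Bochner_Integration.integral_cong) (auto simp: D_def j0_def q0_def)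
  qed
  have D2m: "(\<lambda>u. (D u)\<^sup>2) \<in> borel_measurable borel" by measurable
  have DU_int: "integrable P (\<lambda>\<omega>. (D (U \<omega>))\<^sup>2)"
    using integrable_distr_eq[OF Um D2m] integrable_distr_eq[OF idm D2m] dU D_int by simp
  have DU_eq: "(\<integral>\<omega>. (D (U \<omega>))\<^sup>2 \<partial>P) = (\<integral>u. (j u - q u)\<^sup>2 \<partial>L01)"
    using integral_distr[OF Um D2m] integral_distr[OF idm D2m] dU D_eq by simp
  \<comment> \<open>By \<open>linear_decomposition_shift\<close>, a step of c along \<beta> raises g
    by c times the squared norm of \<beta>, so this c raises it by exactly D(U).\<close>
  define c where "c \<omega> = D (U \<omega>) / (norm \<beta>)\<^sup>2" for \<omega>
  define Y where "Y \<omega> = X \<omega> + c \<omega> *\<^sub>R \<beta>" for \<omega>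
  have norm_c: "(norm (c \<omega> *\<^sub>R \<beta>))\<^sup>2 = (D (U \<omega>))\<^sup>2 / (norm \<beta>)\<^sup>2" for \<omega>
  proof -
    define N where "N = (norm \<beta>)\<^sup>2"
    have "N \<noteq> 0" using False by (simp add: N_def)
    have "(norm (c \<omega> *\<^sub>R \<beta>))\<^sup>2 = (c \<omega>)\<^sup>2 * N"
      by (simp add: power_mult_distrib N_def)
    also have "\<dots> = (D (U \<omega>))\<^sup>2 / N"
      unfolding c_def N_def[symmetric] using \<open>N \<noteq> 0\<close> by (simp add: power2_eq_square)
    finally show ?thesis unfolding N_def .
  qed
  have "square_integrable P (\<lambda>\<omega>. c \<omega> *\<^sub>R \<beta>)"
    unfolding square_integrable_def norm_c using DU_int by (auto simp: c_def)
  then have Y: "square_integrable P Y" unfolding Y_def by (rule square_integrable_add[OF X])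
  have "(\<integral>\<omega>. (norm (Y \<omega> - X \<omega>))\<^sup>2 \<partial>P) = (\<integral>u. (j u - q u)\<^sup>2 \<partial>L01) / (norm \<beta>)\<^sup>2"
    by (simp add: Y_def norm_c DU_eq del: norm_scaleR)
  also have "\<dots> \<le> \<epsilon>\<^sup>2" using dist False unfolding q_def by (simp add: divide_le_eq mult.commute)
  finally have ball: "Y \<in> wasserstein_ball P X \<epsilon>" by (rule wasserstein_ballI[OF P X Y \<epsilon>])
  have gYm: "g \<circ> Y \<in> borel_measurable P"
    using square_integrable_comp_lipschitz[OF P Y g] by (simp add: square_integrable_real)
  have gY: "AE \<omega> in P. (g \<circ> Y) \<omega> = j0 (U \<omega>)"
    using U
  proof eventually_elim
    case (elim \<omega>)
    have "g (Y \<omega>) = g (X \<omega>) + D (U \<omega>)"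
      using linear_decomposition_shift[OF dec, of "X \<omega>" "c \<omega>"] False by (simp add: Y_def c_def)
    then show ?case using elim by (simp add: D_def j0_def q0_def)
  qed
  have "distr P borel (g \<circ> Y) = distr P borel (\<lambda>\<omega>. j0 (U \<omega>))"
    using gY by (intro distr_cong_AE) (auto intro: gYm)
  also have "\<dots> = distr (distr P borel U) borel j0"
    using distr_distr[OF j0m Um] by (simp add: comp_def)
  also have "\<dots> = distr L01 borel j0" unfolding dU using distr_distr[OF j0m idm] by (simp add: comp_def)
  also have "\<dots> = distr L01 borel j" by (rule distr_cong) (auto simp: j0_def)
  finally have "AE u in L01. quantile P (g \<circ> Y) u = j u"
    by (rule quantile_AE_eq_of_distr[OF gYm j jsq])
  with ball show ?thesis by (rule that)
qed

text \<open>The supremum is taken in \<open>ereal\<close>, so the real upper bounds also assert that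
  it is not infinite.\<close>

theorem proposition6:
  fixes P :: "(real ^ 'n::finite) measure"
    and X :: "real ^ 'n \<Rightarrow> real ^ 'n"
    and g g' :: "real ^ 'n \<Rightarrow> real"
    and J :: "'n set"
    and \<beta> :: "real ^ 'n"
    and h \<gamma> :: "real \<Rightarrow> real"
    and K \<epsilon> :: real
  assumes "prob_space P" and "sets P = sets borel" and "nonatomic P"
    and "distortion h" and "distortion_weight h \<gamma>"
    and "square_integrable (lebesgue_on {0<..<1}) \<gamma>" and "0 < L2_norm \<gamma>"
    and "K-lipschitz_on UNIV g" and "\<not> g constant_on UNIV"
    and "linear_decomposition g J g' \<beta>"
    and "square_integrable P X" and "square_integrable P (g \<circ> X)"
    and "0 < \<epsilon>"
  defines "worst \<equiv> (SUP Y\<in>wasserstein_ball P X \<epsilon>. ereal (choquet P h (g \<circ> Y)))"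
    and "q \<equiv> quantile P (g \<circ> X)"
  shows
    "(mono_on {0<..<1} \<gamma> \<longrightarrow>
        ereal (choquet P h (g \<circ> X) + norm \<beta> * L2_norm \<gamma> * \<epsilon>) \<le> worst \<and>
        worst \<le> ereal (choquet P h (g \<circ> X) + K * L2_norm \<gamma> * \<epsilon>)) \<and>
     ((\<forall>u\<in>{0<..<1}. 0 \<le> \<gamma> u) \<longrightarrow>
        (\<beta> \<noteq> 0 \<longrightarrow>
          (\<exists>!l. 0 < l \<and> projection_cost \<gamma> q l = (norm \<beta>)\<^sup>2 * \<epsilon>\<^sup>2) \<and>
          (\<forall>l. 0 < l \<and> projection_cost \<gamma> q l = (norm \<beta>)\<^sup>2 * \<epsilon>\<^sup>2 \<longrightarrow>
            ereal (\<integral>u. \<gamma> u * shifted_projection \<gamma> q l u \<partial>lebesgue_on {0<..<1}) \<le> worst)) \<and>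
        (\<beta> = 0 \<longrightarrow>
          ereal (\<integral>u. \<gamma> u * isotonic_projection q u \<partial>lebesgue_on {0<..<1}) \<le> worst) \<and>
        (\<exists>!l. 0 < l \<and> projection_cost \<gamma> q l = K\<^sup>2 * \<epsilon>\<^sup>2) \<and>
        (\<forall>l. 0 < l \<and> projection_cost \<gamma> q l = K\<^sup>2 * \<epsilon>\<^sup>2 \<longrightarrow>
          worst \<le> ereal (\<integral>u. \<gamma> u * shifted_projection \<gamma> q l u \<partial>lebesgue_on {0<..<1})))"
proof -
  note P = assms(1) and sets = assms(2) and na = assms(3) and h = assms(4) and w = assms(5)
    and \<gamma> = assms(6) and \<gamma>pos = assms(7) and g = assms(8) and nc = assms(9) and dec = assms(10)
    and X = assms(11) and gX = assms(12) and \<epsilon> = assms(13)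
  interpret prob_space P by (rule P)
  \<comment> \<open>Non-constancy of g excludes K = 0, for which the upper equation in case (ii)
    would have no positive solution.\<close>
  have K: "0 < K"
  proof (rule ccontr)
    assume "\<not> 0 < K"
    then have "K = 0" using lipschitz_on_nonneg[OF g] by simp
    then have "g x = g 0" for x using lipschitz_onD[OF g, of x 0] by simp
    then show False using nc unfolding constant_on_def by blast
  qed
  have q: "q \<in> isotonic_cone" unfolding q_def by (rule quantile_in_isotonic_cone[OF gX])
  note qsq = isotonic_coneD(2)[OF q]
  have \<gamma>2: "(L2_norm \<gamma>)\<^sup>2 = (\<integral>u. (\<gamma> u)\<^sup>2 \<partial>L01)" by (simp add: L2_norm_def)
  have choquet: "choquet P h (g \<circ> Y) = (\<integral>u. \<gamma> u * quantile P (g \<circ> Y) u \<partial>L01)"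
    if "square_integrable P Y" for Y
    by (rule choquet_eq_quantile_integral[OF square_integrable_comp_lipschitz[OF P that g] h w \<gamma>])
  have cX: "choquet P h (g \<circ> X) = (\<integral>u. \<gamma> u * q u \<partial>L01)" unfolding q_def by (rule choquet[OF X])
  \<comment> \<open>From here on only functions on (0,1) matter: \<open>lower\<close> accepts any
    monotone j within norm \<beta> times \<epsilon> of q, and \<open>upper\<close> any bound over
    the isotonic functions within K \<epsilon> of q.\<close>
  have lower: "ereal (\<integral>u. \<gamma> u * j u \<partial>L01) \<le> worst"
    if j: "mono_on {0<..<1} j" and jsq: "square_integrable L01 j"
      and dist: "(\<integral>u. (j u - q u)\<^sup>2 \<partial>L01) \<le> (norm \<beta>)\<^sup>2 * \<epsilon>\<^sup>2" for j
  proof -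
    obtain Y where Y: "Y \<in> wasserstein_ball P X \<epsilon>" and AE: "AE u in L01. quantile P (g \<circ> Y) u = j u"
      using wasserstein_ball_realizes_quantile[OF P sets na g dec X less_imp_le[OF \<epsilon>] j jsq]
        dist unfolding q_def by blast
    have Ysq: "square_integrable P Y" using Y by (simp add: wasserstein_ball_def)
    have "(\<integral>u. \<gamma> u * quantile P (g \<circ> Y) u \<partial>L01) = (\<integral>u. \<gamma> u * j u \<partial>L01)"
    proof (rule integral_cong_AE)
      show "AE u in L01. \<gamma> u * quantile P (g \<circ> Y) u = \<gamma> u * j u" using AE by eventually_elim simp
    qed (use \<gamma> jsq square_integrable_quantile[OF square_integrable_comp_lipschitz[OF P Ysq g]] in
        \<open>auto simp: square_integrable_real\<close>)
    then have "ereal (\<integral>u. \<gamma> u * j u \<partial>L01) = ereal (choquet P h (g \<circ> Y))" using choquet[OF Ysq] by simp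
    also have "\<dots> \<le> worst" unfolding worst_def by (rule SUP_upper[OF Y])
    finally show ?thesis .
  qed
  have upper: "worst \<le> ereal c"
    if "\<And>j. j \<in> isotonic_cone \<Longrightarrow> (\<integral>u. (q u - j u)\<^sup>2 \<partial>L01) \<le> K\<^sup>2 * \<epsilon>\<^sup>2 \<Longrightarrow> (\<integral>u. \<gamma> u * j u \<partial>L01) \<le> c" for c
    unfolding worst_def
  proof (rule SUP_least)
    fix Y assume Y: "Y \<in> wasserstein_ball P X \<epsilon>"
    then have Ysq: "square_integrable P Y" by (simp add: wasserstein_ball_def)
    have "(\<integral>u. \<gamma> u * quantile P (g \<circ> Y) u \<partial>L01) \<le> c"
      using quantile_distance_wasserstein_ball[OF P X Y g K] unfolding q_def[symmetric]
      by (intro that quantile_in_isotonic_cone square_integrable_comp_lipschitz[OF P Ysq g]) auto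
    then show "ereal (choquet P h (g \<circ> Y)) \<le> ereal c" using choquet[OF Ysq] by simp
  qed
  have i_lower: "ereal (choquet P h (g \<circ> X) + norm \<beta> * L2_norm \<gamma> * \<epsilon>) \<le> worst"
    if mono: "mono_on {0<..<1} \<gamma>"
  proof -
    \<comment> \<open>The step c \<gamma> has norm exactly norm \<beta> times \<epsilon> and points
      in the direction of equality in Cauchy-Schwarz; monotonicity of \<gamma> keeps q + c \<gamma>
      monotone.\<close>
    define c where "c = norm \<beta> * \<epsilon> / L2_norm \<gamma>"
    have c0: "0 \<le> c" using \<epsilon> \<gamma>pos by (simp add: c_def)
    have mono': "mono_on {0<..<1} (\<lambda>u. q u + c * \<gamma> u)"
      using mono isotonic_coneD(1)[OF q] c0 by (auto simp: mono_on_def intro!: add_mono mult_left_mono)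
    have sq: "square_integrable L01 (\<lambda>u. q u + c * \<gamma> u)"
      by (rule square_integrable_add[OF qsq square_integrable_cmult[OF \<gamma>]])
    have "(\<integral>u. (q u + c * \<gamma> u - q u)\<^sup>2 \<partial>L01) = (norm \<beta>)\<^sup>2 * \<epsilon>\<^sup>2"
      using \<gamma>pos by (simp add: power_mult_distrib c_def power_divide flip: \<gamma>2)
    then have "ereal (\<integral>u. \<gamma> u * (q u + c * \<gamma> u) \<partial>L01) \<le> worst" by (intro lower mono' sq) simp
    also have "(\<integral>u. \<gamma> u * (q u + c * \<gamma> u) \<partial>L01) = (\<integral>u. \<gamma> u * q u + c * (\<gamma> u * \<gamma> u) \<partial>L01)"
      by (intro Bochner_Integration.integral_cong) (auto simp: algebra_simps)
    also have "\<dots> = (\<integral>u. \<gamma> u * q u \<partial>L01) + c * (L2_norm \<gamma>)\<^sup>2"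
      using integrable_mult_square_integrable[OF \<gamma> qsq] integrable_mult_square_integrable[OF \<gamma> \<gamma>] \<gamma>2
      by (simp add: power2_eq_square)
    also have "c * (L2_norm \<gamma>)\<^sup>2 = norm \<beta> * L2_norm \<gamma> * \<epsilon>"
      using \<gamma>pos by (simp add: c_def power2_eq_square)
    finally show ?thesis unfolding cX .
  qed
  have i_upper: "worst \<le> ereal (choquet P h (g \<circ> X) + K * L2_norm \<gamma> * \<epsilon>)"
  proof (rule upper)
    fix j assume j: "j \<in> isotonic_cone" and dist: "(\<integral>u. (q u - j u)\<^sup>2 \<partial>L01) \<le> K\<^sup>2 * \<epsilon>\<^sup>2"
    note jsq = isotonic_coneD(2)[OF j]
    have "(\<integral>u. \<gamma> u * (j u - q u) \<partial>L01)\<^sup>2 \<le> (L2_norm \<gamma>)\<^sup>2 * (\<integral>u. (j u - q u)\<^sup>2 \<partial>L01)"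
      unfolding \<gamma>2 by (rule integral_Cauchy_Schwarz[OF \<gamma> square_integrable_diff[OF jsq qsq]])
    also have "\<dots> \<le> (L2_norm \<gamma>)\<^sup>2 * (K\<^sup>2 * \<epsilon>\<^sup>2)"
      using dist by (intro mult_left_mono) (auto simp: power2_commute)
    also have "\<dots> = (K * L2_norm \<gamma> * \<epsilon>)\<^sup>2" by (simp add: power_mult_distrib)
    finally have "(\<integral>u. \<gamma> u * (j u - q u) \<partial>L01) \<le> K * L2_norm \<gamma> * \<epsilon>"
      by (rule power2_le_imp_le) (use K \<gamma>pos \<epsilon> in simp)
    then show "(\<integral>u. \<gamma> u * j u \<partial>L01) \<le> choquet P h (g \<circ> X) + K * L2_norm \<gamma> * \<epsilon>"
      using integrable_mult_square_integrable[OF \<gamma> qsq] integrable_mult_square_integrable[OF \<gamma> jsq]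
      unfolding cX by (simp add: right_diff_distrib)
  qed
  have ex1: "\<exists>!l. 0 < l \<and> projection_cost \<gamma> q l = b\<^sup>2 * \<epsilon>\<^sup>2"
    if "\<forall>u\<in>{0<..<1}. 0 \<le> \<gamma> u" and "0 < b" for b
    using projection_cost_ex1[OF q \<gamma> integral_pos_of_L2_norm_pos[OF \<gamma> \<gamma>pos], of "b * \<epsilon>"] that \<epsilon>
    by (simp add: power_mult_distrib)
  \<comment> \<open>The equation for l puts the projection exactly on the sphere of admissible
    radius around q.\<close>
  have ii_lower: "ereal (\<integral>u. \<gamma> u * shifted_projection \<gamma> q l u \<partial>L01) \<le> worst"
    if "projection_cost \<gamma> q l = (norm \<beta>)\<^sup>2 * \<epsilon>\<^sup>2" for l
    using that isotonic_coneD[OF shifted_projection_in_cone[OF q \<gamma>, of l]]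
    by (intro lower) (auto simp: projection_cost_def power2_commute)
  \<comment> \<open>q is at distance 0 from itself, so its projection lies in every ball around
    q.\<close>
  have ii_zero: "ereal (\<integral>u. \<gamma> u * isotonic_projection q u \<partial>L01) \<le> worst"
  proof (rule lower)
    show "(\<integral>u. (isotonic_projection q u - q u)\<^sup>2 \<partial>L01) \<le> (norm \<beta>)\<^sup>2 * \<epsilon>\<^sup>2"
      using order_trans[OF isotonic_projection_le[OF qsq q], of "(norm \<beta>)\<^sup>2 * \<epsilon>\<^sup>2"] by simp
  qed (use isotonic_coneD[OF isotonic_projection_in_cone[OF qsq]] in auto)
  have ii_upper: "worst \<le> ereal (\<integral>u. \<gamma> u * shifted_projection \<gamma> q l u \<partial>L01)"
    if "0 < l" "projection_cost \<gamma> q l = K\<^sup>2 * \<epsilon>\<^sup>2" for l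
    using that by (intro upper shifted_projection_optimal[OF q \<gamma>]) auto
  show ?thesis
    using i_lower i_upper ex1 K ii_lower ii_zero ii_upper by simp
qed

end
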